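(* Let $\phi:E\to\,]-\infty,+\infty]$ be proper, lower semicontinuous and convex. Suppose that $\phi$ is strictly convex on its domain and that the Fenchel conjugate $\phi^*$ is differentiable (everywhere) on $E$. Then $I_\phi$ is strongly rotund on $L^1_E(S,\mu)$.
   Context: $d\in\{1,2,3,\dots\}$ and $E=\mathbb{R}^d$ is Euclidean space with its Euclidean norm. $(S,\mu)$ is a complete finite measure space with $\mu\neq 0$. $L^1_E(S,\mu)$ is the Banach space of (equivalence classes of) measurable $f:S\to E$ with $\|f\|_1:=\int_S\|f(s)\|\,d\mu(s)<+\infty$; its dual is $L^\infty_E(S,\mu)$ via $\langle f,g\rangle=\int_S\langle f(s),g(s)\rangle\,d\mu(s)$. For a function $f:X\to\,]-\infty,+\infty]$ on a Banach space, $\operatorname{dom} f:=\{x: f(x)<+\infty\}$, $f$ is proper if $\operatorname{dom} f\neq\varnothing$, and $f^*(x^* ):=\sup_x(\langle x,x^*\rangle-f(x))$. The integral functional is $I_\phi:L^1_E(S,\mu)\to\,]-\infty,+\infty]$, $I_\phi(x):=\int_S\phi(x(s))\,d\mu(s)$. A proper function $f:X\to\,]-\infty,+\infty]$ is strongly rotund if (1) $f$ is strictly convex on its domain; (2) all lower level sets $\{x\in X: f(x)\le\lambda\}$, $\lambda\in\mathbb{R}$, are weakly compact; and (3) $f$ has the Kadec (Kadec--Klee) property: whenever a sequence $(x_n)$ converges weakly to $x\in\operatorname{dom} f$ and $f(x_n)\to f(x)$, then $x_n\to x$ in norm. *)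

theory Defs
  imports "HOL-Analysis.Analysis"
begin

text \<open>
  The space of integrable functions modulo null sets depends on a measure, so it is not a type.
  Normed spaces are therefore given by a carrier together with their operations.
\<close>

record 'x normed_space =
  vcarrier :: "'x set"
  vadd :: "'x \<Rightarrow> 'x \<Rightarrow> 'x"
  vscale :: "real \<Rightarrow> 'x \<Rightarrow> 'x"
  vnorm :: "'x \<Rightarrow> real"

definition type_space :: "'a::real_normed_vector normed_space" where
  "type_space = \<lparr>vcarrier = UNIV, vadd = (+), vscale = (*\<^sub>R), vnorm = norm\<rparr>"

definition vminus :: "'x normed_space \<Rightarrow> 'x \<Rightarrow> 'x \<Rightarrow> 'x" where
  "vminus X x y = vadd X x (vscale X (-1) y)"

definition dual_functionals :: "'x normed_space \<Rightarrow> ('x \<Rightarrow> real) set" where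
  "dual_functionals X =
    {\<Lambda>. (\<forall>x\<in>vcarrier X. \<forall>y\<in>vcarrier X. \<Lambda> (vadd X x y) = \<Lambda> x + \<Lambda> y) \<and>
        (\<forall>c. \<forall>x\<in>vcarrier X. \<Lambda> (vscale X c x) = c * \<Lambda> x) \<and>
        (\<exists>C. \<forall>x\<in>vcarrier X. \<bar>\<Lambda> x\<bar> \<le> C * vnorm X x)}"

definition weak_topology :: "'x normed_space \<Rightarrow> 'x topology" where
  "weak_topology X = topology_generated_by
    {{x \<in> vcarrier X. \<Lambda> x \<in> U} | \<Lambda> U. \<Lambda> \<in> dual_functionals X \<and> open U}"

lemma topspace_weak_topology: "topspace (weak_topology X) = vcarrier X"
proof -
  have "(\<lambda>x. 0) \<in> dual_functionals X"
    by (auto simp: dual_functionals_def intro!: exI[of _ 0])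
  then have "vcarrier X \<in> {{x \<in> vcarrier X. \<Lambda> x \<in> U} | \<Lambda> U. \<Lambda> \<in> dual_functionals X \<and> open U}"
    by (auto intro!: exI[of _ "\<lambda>x. 0"] exI[of _ "UNIV :: real set"])
  then show ?thesis
    unfolding weak_topology_def topology_generated_by_topspace by blast
qed


definition effective_dom :: "'x normed_space \<Rightarrow> ('x \<Rightarrow> ereal) \<Rightarrow> 'x set" where
  "effective_dom X f = {x \<in> vcarrier X. f x < \<infinity>}"

text \<open>The first conjunct says that the codomain is \<open>]-\<infinity>,+\<infinity>]\<close>.\<close>

definition proper_function :: "'x normed_space \<Rightarrow> ('x \<Rightarrow> ereal) \<Rightarrow> bool" where
  "proper_function X f \<longleftrightarrow> (\<forall>x\<in>vcarrier X. f x \<noteq> -\<infinity>) \<and> effective_dom X f \<noteq> {}"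

text \<open>
  In \<^typ>\<open>ereal\<close>, \<open>0 * \<infinity> = 0\<close>, so the cases \<open>t = 0\<close> and \<open>t = 1\<close> below are trivially true.
\<close>

definition convex_function :: "'x normed_space \<Rightarrow> ('x \<Rightarrow> ereal) \<Rightarrow> bool" where
  "convex_function X f \<longleftrightarrow>
    (\<forall>x\<in>vcarrier X. \<forall>y\<in>vcarrier X. \<forall>t\<in>{0..1::real}.
      f (vadd X (vscale X (1 - t) x) (vscale X t y)) \<le> ereal (1 - t) * f x + ereal t * f y)"

definition strictly_convex_on_dom :: "'x normed_space \<Rightarrow> ('x \<Rightarrow> ereal) \<Rightarrow> bool" where
  "strictly_convex_on_dom X f \<longleftrightarrow>
    (\<forall>x\<in>effective_dom X f. \<forall>y\<in>effective_dom X f. \<forall>t\<in>{0<..<1::real}. x \<noteq> y \<longrightarrow>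
      f (vadd X (vscale X (1 - t) x) (vscale X t y)) < ereal (1 - t) * f x + ereal t * f y)"

definition kadec_property :: "'x normed_space \<Rightarrow> ('x \<Rightarrow> ereal) \<Rightarrow> bool" where
  "kadec_property X f \<longleftrightarrow>
    (\<forall>xs x. (\<forall>n. xs n \<in> vcarrier X) \<and> x \<in> effective_dom X f \<and>
        limitin (weak_topology X) xs x sequentially \<and> (\<lambda>n. f (xs n)) \<longlonglongrightarrow> f x \<longrightarrow>
      (\<lambda>n. vnorm X (vminus X (xs n) x)) \<longlonglongrightarrow> 0)"

definition strongly_rotund :: "'x normed_space \<Rightarrow> ('x \<Rightarrow> ereal) \<Rightarrow> bool" where
  "strongly_rotund X f \<longleftrightarrow>
    proper_function X f \<and>
    strictly_convex_on_dom X f \<and>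
    (\<forall>r::real. compactin (weak_topology X) {x \<in> vcarrier X. f x \<le> ereal r}) \<and>
    kadec_property X f"


definition lower_semicontinuous :: "('a::topological_space \<Rightarrow> ereal) \<Rightarrow> bool" where
  "lower_semicontinuous f \<longleftrightarrow> (\<forall>x. \<forall>c < f x. eventually (\<lambda>y. c < f y) (nhds x))"

definition fenchel_conjugate :: "('a::real_inner \<Rightarrow> ereal) \<Rightarrow> 'a \<Rightarrow> ereal" where
  "fenchel_conjugate f y = (SUP x. ereal (x \<bullet> y) - f x)"

text \<open>
  Differentiability (Frechet) of an extended-real-valued function includes finiteness;
  \<^const>\<open>real_of_ereal\<close> alone would send infinite values to \<open>0\<close>.
\<close>

definition differentiable_everywhere :: "('a::real_normed_vector \<Rightarrow> ereal) \<Rightarrow> bool" where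
  "differentiable_everywhere f \<longleftrightarrow>
    (\<forall>y. \<bar>f y\<bar> \<noteq> \<infinity>) \<and> (\<forall>y. (\<lambda>z. real_of_ereal (f z)) differentiable (at y))"


definition ae_class :: "'s measure \<Rightarrow> ('s \<Rightarrow> 'e::euclidean_space) \<Rightarrow> ('s \<Rightarrow> 'e) set" where
  "ae_class M f = {g \<in> borel_measurable M. AE s in M. g s = f s}"

definition ae_rep :: "('s \<Rightarrow> 'e) set \<Rightarrow> 's \<Rightarrow> 'e" where
  "ae_rep F = (SOME f. f \<in> F)"

definition L1_space :: "'s measure \<Rightarrow> ('s \<Rightarrow> 'e::euclidean_space) set normed_space" where
  "L1_space M =
    \<lparr>vcarrier = {ae_class M f | f. integrable M f},
     vadd = (\<lambda>F G. ae_class M (\<lambda>s. ae_rep F s + ae_rep G s)),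
     vscale = (\<lambda>c F. ae_class M (\<lambda>s. c *\<^sub>R ae_rep F s)),
     vnorm = (\<lambda>F. LINT s|M. norm (ae_rep F s))\<rparr>"

text \<open>
  Since \<open>\<infinity> - c = \<infinity>\<close> for finite \<open>c\<close>, this is the usual integral whenever the negative part of
  \<open>h\<close> has finite integral; when both parts have infinite integral, the value is
  \<open>\<infinity> - \<infinity> = \<infinity>\<close>. The function \<^const>\<open>e2ennreal\<close> sends negative values to \<open>0\<close>.
\<close>

definition ereal_integral :: "'s measure \<Rightarrow> ('s \<Rightarrow> ereal) \<Rightarrow> ereal" where
  "ereal_integral M h =
    enn2ereal (\<integral>\<^sup>+s. e2ennreal (h s) \<partial>M) - enn2ereal (\<integral>\<^sup>+s. e2ennreal (- h s) \<partial>M)"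

definition integral_functional ::
    "'s measure \<Rightarrow> ('e \<Rightarrow> ereal) \<Rightarrow> ('s \<Rightarrow> 'e::euclidean_space) set \<Rightarrow> ereal" where
  "integral_functional M \<phi> F = ereal_integral M (\<lambda>s. \<phi> (ae_rep F s))"


text \<open>The operations and the integral functional do not depend on the chosen representatives.\<close>

lemma ae_class_eqI:
  assumes "AE s in M. f s = g s"
  shows "ae_class M f = ae_class M g"
  using assms unfolding ae_class_def by (auto elim!: eventually_elim2)

lemma ae_rep_ae_class:
  assumes "f \<in> borel_measurable M"
  shows "ae_rep (ae_class M f) \<in> borel_measurable M" "AE s in M. ae_rep (ae_class M f) s = f s"
proof -
  have "f \<in> ae_class M f" using assms by (simp add: ae_class_def)
  then have "ae_rep (ae_class M f) \<in> ae_class M f"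
    unfolding ae_rep_def by (rule someI[of "\<lambda>h. h \<in> ae_class M f"])
  then show "ae_rep (ae_class M f) \<in> borel_measurable M"
    "AE s in M. ae_rep (ae_class M f) s = f s"
    by (auto simp: ae_class_def)
qed

lemma L1_space_ae_class:
  fixes f g :: "'s \<Rightarrow> 'e::euclidean_space"
  assumes "integrable M f" "integrable M g"
  shows "vadd (L1_space M) (ae_class M f) (ae_class M g) = ae_class M (\<lambda>s. f s + g s)"
    and "vscale (L1_space M) c (ae_class M f) = ae_class M (\<lambda>s. c *\<^sub>R f s)"
    and "vnorm (L1_space M) (ae_class M f) = (LINT s|M. norm (f s))"
proof -
  have f: "f \<in> borel_measurable M" and g: "g \<in> borel_measurable M"
    using assms by auto
  note F = ae_rep_ae_class[OF f] and G = ae_rep_ae_class[OF g]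
  have "AE s in M. ae_rep (ae_class M f) s + ae_rep (ae_class M g) s = f s + g s"
    using F(2) G(2) by eventually_elim simp
  then show "vadd (L1_space M) (ae_class M f) (ae_class M g) = ae_class M (\<lambda>s. f s + g s)"
    by (simp add: L1_space_def ae_class_eqI)
  have "AE s in M. c *\<^sub>R ae_rep (ae_class M f) s = c *\<^sub>R f s"
    using F(2) by eventually_elim simp
  then show "vscale (L1_space M) c (ae_class M f) = ae_class M (\<lambda>s. c *\<^sub>R f s)"
    by (simp add: L1_space_def ae_class_eqI)
  have "AE s in M. norm (ae_rep (ae_class M f) s) = norm (f s)"
    using F(2) by eventually_elim simp
  then show "vnorm (L1_space M) (ae_class M f) = (LINT s|M. norm (f s))"
    using F(1) f by (auto simp: L1_space_def intro!: integral_cong_AE)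
qed

lemma integral_functional_ae_class:
  assumes "f \<in> borel_measurable M"
  shows "integral_functional M \<phi> (ae_class M f) = ereal_integral M (\<lambda>s. \<phi> (f s))"
proof -
  have "AE s in M. ae_rep (ae_class M f) s = f s"
    using assms by (rule ae_rep_ae_class)
  then have
    "(\<integral>\<^sup>+s. e2ennreal (\<phi> (ae_rep (ae_class M f) s)) \<partial>M) = (\<integral>\<^sup>+s. e2ennreal (\<phi> (f s)) \<partial>M)"
    "(\<integral>\<^sup>+s. e2ennreal (- \<phi> (ae_rep (ae_class M f) s)) \<partial>M) = (\<integral>\<^sup>+s. e2ennreal (- \<phi> (f s)) \<partial>M)"
    by (auto intro!: nn_integral_cong_AE elim!: eventually_mono)
  then show ?thesis
    by (simp add: integral_functional_def ereal_integral_def)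
qed

end

theory Submission
  imports Defs
begin

text \<open>
  Let \<open>\<psi> = \<phi>\<^sup>*\<close>. Finiteness of \<open>\<psi>\<close> makes \<open>\<phi>\<close> superlinear, so the level sets of the integral
  functional are uniformly integrable. Its weak lower semicontinuity comes from the affine minorants
  \<open>f \<mapsto> \<integral> f \<bullet> g - \<psi> \<circ> g\<close> with \<open>g\<close> bounded, so the level sets are also weakly closed and the
  Dunford-Pettis criterion applies.

  For the Kadec property it is enough to bound the measure of \<open>{u \<bullet> (f\<^sub>n - f) \<ge> \<epsilon>}\<close>. By strict convexity,
  for every \<open>x\<close> in the domain and \<open>\<theta> \<in> ]0,1[\<close> there are \<open>y\<close> and \<open>\<eta> > 0\<close> such that the gap
  \<open>\<phi> w - w \<bullet> y + \<psi> y \<ge> 0\<close> is below \<open>\<theta> \<eta>\<close> at \<open>w = x\<close> and at least \<open>\<eta>\<close> on the half-space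
  \<open>u \<bullet> (w - x) \<ge> \<epsilon>\<close>; this replaces a subgradient at \<open>x\<close>, which need not exist. Countably many \<open>y\<close>
  suffice, and since the integral of the gap along \<open>f\<^sub>n\<close> converges to the one along \<open>f\<close> on every
  measurable set, Markov's inequality bounds the measure by about \<open>\<theta>\<close>.
\<close>

section \<open>Strictly convex functions with finite continuous conjugate\<close>

text \<open>Differentiability of the conjugate enters as finiteness and continuity of \<psi>.
  Boundedness of \<psi> on balls gives the superlinear growth, and continuity lets each affine bound
  survive a small move of its slope into a countable dense set. Half-spaces replace balls in the
  Kadec part because separation needs the set of far points to be convex. Nothing is lost: the norm
  is at most the sum of the positive parts of plus and minus the coordinates. A one-sided deviation
  that is small in measure, together with uniform integrability, makes the integral of its positive
  part vanish. The slope \<open>y\<close> that works depends on the value \<open>f s\<close>, so the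
  estimate is made on pieces of the measure space where \<open>y\<close> and two rational parameters
  are constant. Countably many pieces cover almost everything and finitely many cover up to small
  measure; each contributes about \<theta> times its own measure, so the sum stays small. Weak
  compactness is meant for open covers, not for sequences, hence the detour through a compact
  product.\<close>

lemma exists_affine_minorant_above:
  fixes Q :: "('a::euclidean_space \<times> real) set"
  assumes Q: "closed Q" "convex Q"
    and up: "\<And>x a b. (x, a) \<in> Q \<Longrightarrow> a \<le> b \<Longrightarrow> (x, b) \<in> Q"
    and lower: "\<And>x a. (x, a) \<in> Q \<Longrightarrow> m \<le> a"
    and z: "(z, c) \<notin> Q"
  obtains y b where "c < z \<bullet> y - b" "\<And>x a. (x, a) \<in> Q \<Longrightarrow> x \<bullet> y - b \<le> a"
proof -
  from separating_hyperplane_closed_point[OF Q(2,1) z] obtain p r where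
    "p \<bullet> (z, c) < r" "\<forall>x\<in>Q. r < p \<bullet> x" by blast
  moreover obtain u k where "p = (u, k)" by fastforce
  ultimately have less: "u \<bullet> z + k * c < r"
    and above: "\<And>x a. (x, a) \<in> Q \<Longrightarrow> r < u \<bullet> x + k * a"
    by (auto simp: inner_Pair)
  show thesis
  proof (cases "Q = {}")
    case True
    then show thesis by (intro that[of 0 "- c - 1"]) auto
  next
    case False
    then obtain x0 a0 where x0: "(x0, a0) \<in> Q" by fastforce
    \<comment> \<open>If \<open>k\<close> were negative, climbing in \<open>Q\<close> above
      \<open>x0\<close> would push \<open>u \<bullet> x0 + k * a\<close> down to \<open>r\<close>;
      the height \<open>a\<close> below does exactly this.\<close>
    have "k \<ge> 0"
    proof (rule ccontr)
      assume neg: "\<not> k \<ge> 0"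
      define a where "a = max a0 ((r - u \<bullet> x0) / k)"
      have "r < u \<bullet> x0 + k * a"
        by (intro above up[OF x0]) (simp add: a_def)
      moreover have "k * a \<le> k * ((r - u \<bullet> x0) / k)"
        using neg by (intro mult_left_mono_neg) (auto simp: a_def)
      ultimately show False using neg by simp
    qed
    show thesis
    proof (cases "k = 0")
      case False
      with \<open>k \<ge> 0\<close> have k: "k > 0" by simp
      show thesis
      proof (rule that[of "- (1 / k) *\<^sub>R u" "- r / k"])
        show "c < z \<bullet> (- (1 / k) *\<^sub>R u) - - r / k"
          using less k by (simp add: field_simps inner_commute)
        show "x \<bullet> (- (1 / k) *\<^sub>R u) - - r / k \<le> a" if "(x, a) \<in> Q" for x a
          using above[OF that] k by (simp add: field_simps inner_commute)
      qed
    next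
      case True
      \<comment> \<open>A vertical hyperplane bounds no heights. But
        \<open>r - u \<bullet> x\<close> is negative over \<open>Q\<close> and positive at
        \<open>z\<close>, so any positive multiple of it may be added to the constant minorant
        \<open>m\<close>; this \<open>t\<close> lifts the value at \<open>z\<close> above
        \<open>c\<close>.\<close>
      define t where "t = (max 0 (c - m) + 1) / (r - u \<bullet> z)"
      have d: "r - u \<bullet> z > 0" using less True by simp
      then have t: "t > 0" by (auto simp: t_def intro!: divide_pos_pos)
      have td: "t * (r - u \<bullet> z) = max 0 (c - m) + 1" using d by (simp add: t_def)
      show thesis
      proof (rule that[of "- t *\<^sub>R u" "- m - t * r"])
        show "c < z \<bullet> (- t *\<^sub>R u) - (- m - t * r)"
          using td by (simp add: algebra_simps inner_commute)
        show "x \<bullet> (- t *\<^sub>R u) - (- m - t * r) \<le> a" if "(x, a) \<in> Q" for x a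
        proof -
          have "t * r \<le> t * (u \<bullet> x)"
            using above[OF that] True t by (intro mult_left_mono) auto
          then show ?thesis using lower[OF that] by (simp add: inner_commute)
        qed
      qed
    qed
  qed
qed

lemma lower_semicontinuous_closed_epigraph:
  assumes "lower_semicontinuous f"
  shows "closed {p. f (fst p) \<le> ereal (snd p)}"
proof -
  have "open (- {p. f (fst p) \<le> ereal (snd p)})"
  proof (rule Topological_Spaces.openI)
    fix p assume "p \<in> - {p. f (fst p) \<le> ereal (snd p)}"
    then have "ereal (snd p) < f (fst p)" by auto
    then obtain c where c: "ereal (snd p) < ereal c" "ereal c < f (fst p)"
      using ereal_dense2 by blast
    then have "\<forall>\<^sub>F x in nhds (fst p). ereal c < f x"
      using assms by (auto simp: lower_semicontinuous_def)
    then obtain U where U: "open U" "fst p \<in> U" "\<And>x. x \<in> U \<Longrightarrow> ereal c < f x"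
      unfolding eventually_nhds by blast
    show "\<exists>T. open T \<and> p \<in> T \<and> T \<subseteq> - {p. f (fst p) \<le> ereal (snd p)}"
    proof (intro exI conjI)
      show "open (U \<times> {..<c})" using U by (intro open_Times) auto
      show "p \<in> U \<times> {..<c}" using U c by (cases p) auto
      have "ereal a < f x" if "x \<in> U" "a < c" for x a
        by (rule less_trans[of _ "ereal c"]) (use U(3) that in auto)
      then show "U \<times> {..<c} \<subseteq> - {p. f (fst p) \<le> ereal (snd p)}"
        by (force dest: leD)
    qed
  qed
  then show ?thesis by (simp add: closed_def)
qed

lemma lower_semicontinuous_borel_measurable:
  assumes "lower_semicontinuous f"
  shows "f \<in> borel_measurable borel"
proof -
  have "open {x. c < f x}" for c
  proof (rule Topological_Spaces.openI)
    fix x assume "x \<in> {x. c < f x}"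
    then have "\<forall>\<^sub>F x in nhds x. c < f x"
      using assms by (auto simp: lower_semicontinuous_def)
    then show "\<exists>T. open T \<and> x \<in> T \<and> T \<subseteq> {x. c < f x}"
      unfolding eventually_nhds by auto
  qed
  then have "f -` {c<..} \<in> sets borel" for c
    by (auto simp: vimage_def)
  then show ?thesis by (subst borel_measurable_ereal_iff_Ioi) auto
qed

section \<open>Growth, epigraph and biconjugation for a conjugate that is finite and
  continuous\<close>

locale strictly_convex_conjugate =
  fixes \<phi> :: "'e::euclidean_space \<Rightarrow> ereal" and \<psi> :: "'e \<Rightarrow> real"
  assumes lsc: "lower_semicontinuous \<phi>"
    and conv: "convex_function type_space \<phi>"
    and strict: "strictly_convex_on_dom type_space \<phi>"
    and proper: "proper_function type_space \<phi>"
    and conjugate: "fenchel_conjugate \<phi> = (\<lambda>y. ereal (\<psi> y))"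
    and cont: "continuous_on UNIV \<psi>"
begin

lemma not_MInfty: "\<phi> x \<noteq> -\<infinity>"
  using proper by (auto simp: proper_function_def type_space_def)

lemma exists_dom: "\<exists>x. \<phi> x < \<infinity>"
  using proper by (auto simp: proper_function_def type_space_def effective_dom_def)

lemma young: "ereal (x \<bullet> y - \<psi> y) \<le> \<phi> x"
proof -
  have "ereal (x \<bullet> y) - \<phi> x \<le> fenchel_conjugate \<phi> y"
    unfolding fenchel_conjugate_def by (rule SUP_upper) simp
  then show ?thesis using not_MInfty[of x] by (cases "\<phi> x") (auto simp: conjugate)
qed

lemma conjugate_le:
  assumes "\<And>x. ereal (x \<bullet> y - b) \<le> \<phi> x"
  shows "\<psi> y \<le> b"
proof -
  have "ereal (x \<bullet> y) - \<phi> x \<le> ereal b" for x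
    using assms[of x] not_MInfty[of x] by (cases "\<phi> x") auto
  then have "fenchel_conjugate \<phi> y \<le> ereal b"
    unfolding fenchel_conjugate_def by (rule SUP_least)
  then show ?thesis by (simp add: conjugate)
qed

lemma convexD:
  assumes "0 \<le> t" "t \<le> 1" "\<phi> x \<le> ereal a" "\<phi> y \<le> ereal b"
  shows "\<phi> ((1 - t) *\<^sub>R x + t *\<^sub>R y) \<le> ereal ((1 - t) * a + t * b)"
proof -
  have "\<phi> ((1 - t) *\<^sub>R x + t *\<^sub>R y) \<le> ereal (1 - t) * \<phi> x + ereal t * \<phi> y"
    using conv assms by (auto simp: convex_function_def type_space_def)
  also have "\<dots> \<le> ereal (1 - t) * ereal a + ereal t * ereal b"
    using assms by (intro add_mono ereal_mult_left_mono) auto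
  finally show ?thesis by simp
qed

lemma strictD:
  assumes "0 < t" "t < 1" "\<phi> x \<le> ereal a" "\<phi> y \<le> ereal b" "x \<noteq> y"
  shows "\<phi> ((1 - t) *\<^sub>R x + t *\<^sub>R y) < ereal ((1 - t) * a + t * b)"
proof -
  have "\<phi> x < \<infinity>" "\<phi> y < \<infinity>" using assms(3,4) by auto
  then have "\<phi> ((1 - t) *\<^sub>R x + t *\<^sub>R y) < ereal (1 - t) * \<phi> x + ereal t * \<phi> y"
    using strict assms by (auto simp: strictly_convex_on_dom_def effective_dom_def type_space_def)
  also have "\<dots> \<le> ereal (1 - t) * ereal a + ereal t * ereal b"
    using assms by (intro add_mono ereal_mult_left_mono) auto
  finally show ?thesis by simp
qed

text \<open>Young's inequality at the slope \<open>R *\<^sub>R sgn x\<close>, which turns the inner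
  product into \<open>R * norm x\<close>. All these slopes lie in one ball, where \<psi> is bounded,
  so a single \<open>C\<close> serves every \<open>x\<close>.\<close>

lemma superlinear:
  obtains C where "0 \<le> C" "\<And>x. ereal (R * norm x - C) \<le> \<phi> x"
proof -
  have "bounded (\<psi> ` cball 0 \<bar>R\<bar>)"
    by (intro compact_imp_bounded compact_continuous_image continuous_on_subset[OF cont]) auto
  then obtain C where "\<forall>y\<in>cball 0 \<bar>R\<bar>. \<bar>\<psi> y\<bar> \<le> C"
    by (auto simp: bounded_iff)
  then have C: "\<bar>\<psi> y\<bar> \<le> C" if "y \<in> cball 0 \<bar>R\<bar>" for y
    using that by blast
  show thesis
  proof (rule that)
    show "0 \<le> C" using C[of 0] by auto
    fix x :: 'e
    have "R * norm x = x \<bullet> (R *\<^sub>R sgn x)"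
      by (cases "x = 0") (simp_all add: sgn_div_norm power2_norm_eq_inner[symmetric] power2_eq_square)
    moreover have "\<bar>\<psi> (R *\<^sub>R sgn x)\<bar> \<le> C"
      by (intro C) (auto simp: norm_sgn)
    ultimately have "R * norm x - C \<le> x \<bullet> (R *\<^sub>R sgn x) - \<psi> (R *\<^sub>R sgn x)" by linarith
    then show "ereal (R * norm x - C) \<le> \<phi> x"
      using young[of x "R *\<^sub>R sgn x"] by (meson ereal_less_eq(3) order_trans)
  qed
qed

text \<open>Young's inequality at slope 0. The modulus makes the constant a nonnegative shift, as
  \<open>ereal_integral_shift\<close> requires.\<close>

lemma lower_bound: "ereal (- \<bar>\<psi> 0\<bar>) \<le> \<phi> x"
proof -
  have "ereal (- \<bar>\<psi> 0\<bar>) \<le> ereal (x \<bullet> 0 - \<psi> 0)" by simp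
  also note young
  finally show ?thesis .
qed

definition epi :: "('e \<times> real) set" where
  "epi = {p. \<phi> (fst p) \<le> ereal (snd p)}"

lemma closed_epi: "closed epi"
  unfolding epi_def by (rule lower_semicontinuous_closed_epigraph[OF lsc])

lemma convex_epi: "convex epi"
  unfolding convex_alt epi_def by (auto intro!: convexD)

lemma epi_bound: "(x, a) \<in> epi \<Longrightarrow> - \<bar>\<psi> 0\<bar> \<le> a"
  using lower_bound[of x] by (force simp: epi_def dest: order_trans)

text \<open>Growth with slope 1 bounds \<open>x\<close> once the height is bounded. This compactness
  yields the closedness of a Minkowski sum in \<open>half_space_gap\<close>.\<close>

lemma compact_epi_truncated: "compact (epi \<inter> {p. snd p \<le> N})"
proof -
  obtain C where C: "\<And>x. ereal (1 * norm x - C) \<le> \<phi> x" using superlinear[of 1] by blast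
  have "epi \<inter> {p. snd p \<le> N} \<subseteq> cball 0 (N + C) \<times> {- \<bar>\<psi> 0\<bar>..N}"
  proof (clarsimp, safe)
    fix x a assume *: "(x, a) \<in> epi" "a \<le> N"
    then show "- \<bar>\<psi> 0\<bar> \<le> a" using epi_bound by blast
    from * have "\<phi> x \<le> ereal a" by (simp add: epi_def)
    with C[of x] have "ereal (1 * norm x - C) \<le> ereal a" by (rule order_trans)
    with * show "norm x \<le> N + C" by simp
  qed
  then have "bounded (epi \<inter> {p. snd p \<le> N})"
    by (rule bounded_subset[rotated]) (intro bounded_Times bounded_cball bounded_closed_interval)
  moreover have "closed (epi \<inter> {p. snd p \<le> N})"
    by (intro closed_Int closed_epi closed_Collect_le continuous_intros)
  ultimately show ?thesis by (simp add: compact_eq_bounded_closed)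
qed

text \<open>Separation gives an affine minorant with some offset \<open>b\<close>; by
  \<open>conjugate_le\<close> the offset \<open>\<psi> y\<close> is at least as good.\<close>

lemma fenchel_moreau:
  assumes "ereal c < \<phi> x"
  obtains y where "c < x \<bullet> y - \<psi> y"
proof -
  have up: "(x, b) \<in> epi" if "(x, a) \<in> epi" "a \<le> b" for x a b
    using that by (auto simp: epi_def intro: order_trans)
  have "(x, c) \<notin> epi" using assms by (simp add: epi_def not_le)
  then obtain y b where y: "c < x \<bullet> y - b" "\<And>x a. (x, a) \<in> epi \<Longrightarrow> x \<bullet> y - b \<le> a"
    using exists_affine_minorant_above[of epi "- \<bar>\<psi> 0\<bar>" x c] closed_epi convex_epi epi_bound up
    by blast
  have "\<psi> y \<le> b"
  proof (rule conjugate_le)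
    show "ereal (x \<bullet> y - b) \<le> \<phi> x" for x
      using y(2)[of x "real_of_ereal (\<phi> x)"] not_MInfty[of x] by (cases "\<phi> x") (auto simp: epi_def)
  qed
  with y(1) show thesis by (intro that[of y]) linarith
qed

text \<open>The slopes with the strict inequality form an open set because \<psi> is continuous.
  With a countable \<open>D\<close>, slopes can later be chosen measurably in
  \<open>x\<close>.\<close>

lemma fenchel_moreau_dense:
  assumes "ereal c < \<phi> x" and D: "\<And>U. open U \<Longrightarrow> U \<noteq> {} \<Longrightarrow> \<exists>d\<in>D. d \<in> U"
  obtains y where "y \<in> D" "c < x \<bullet> y - \<psi> y"
proof -
  have "open {y. c < x \<bullet> y - \<psi> y}"
    by (intro open_Collect_less continuous_intros cont)
  moreover have "{y. c < x \<bullet> y - \<psi> y} \<noteq> {}" using fenchel_moreau[OF assms(1)] by blast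
  ultimately show thesis using D that by blast
qed

text \<open>
  The set of pairs \<open>(1 - \<theta>) p + \<theta> q\<close> with \<open>p, q\<close> in the epigraph and \<open>q\<close> over the half-space is
  closed and, by strict convexity, misses \<open>(x, \<phi> x)\<close>. A separating hyperplane gives \<open>y\<close>.
\<close>

lemma half_space_gap:
  assumes x: "\<phi> x = ereal a" and t: "u \<bullet> x < t" and \<theta>: "0 < \<theta>" "\<theta> < 1"
  obtains y b where "\<And>w. t \<le> u \<bullet> w \<Longrightarrow> ereal (w \<bullet> y - b) \<le> \<phi> w"
    "\<theta> * b + (1 - \<theta>) * \<psi> y < x \<bullet> y - a"
proof -
  define H where "H = epi \<inter> {p. t \<le> u \<bullet> fst p}"
  show thesis
  proof (cases "H = {}")
    case True
    then have top: "\<phi> w = \<infinity>" if "t \<le> u \<bullet> w" for w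
    proof (cases "\<phi> w")
      case (real r)
      then have "(w, r) \<in> H" using that by (simp add: H_def epi_def)
      with True show ?thesis by simp
    qed (use not_MInfty in auto)
    show thesis
    \<comment> \<open>The half-space misses the domain, so its bound is vacuous and \<open>b\<close>
      may be as negative as the second inequality wants: its left side becomes
      \<open>- a - \<theta>\<close>.\<close>
    proof (rule that[of 0 "- ((a + (1 - \<theta>) * \<psi> 0) / \<theta> + 1)"])
      have "\<theta> * - ((a + (1 - \<theta>) * \<psi> 0) / \<theta> + 1) = - (a + (1 - \<theta>) * \<psi> 0) - \<theta>"
        using \<theta> by (simp add: field_simps)
      then show "\<theta> * - ((a + (1 - \<theta>) * \<psi> 0) / \<theta> + 1) + (1 - \<theta>) * \<psi> 0 < x \<bullet> 0 - a"
        using \<theta> by simp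
    qed (auto simp: top)
  next
    case False
    then obtain w0 b0 where w0: "(w0, b0) \<in> H" by fastforce
    define m where "m = - \<bar>\<psi> 0\<bar>"
    have Hcl: "closed H" unfolding H_def
      by (intro closed_Int closed_epi closed_Collect_le continuous_intros)
    have "convex {p::'e\<times>real. t \<le> u \<bullet> fst p}"
      using convex_halfspace_ge[of t "(u, 0::real)"] by (simp add: inner_prod_def)
    then have Hco: "convex H" unfolding H_def by (intro convex_Int convex_epi)
    define Q where "Q = {p + q | p q. p \<in> (*\<^sub>R) (1 - \<theta>) ` epi \<and> q \<in> (*\<^sub>R) \<theta> ` H}"
    have QI: "(1 - \<theta>) *\<^sub>R p + \<theta> *\<^sub>R q \<in> Q" if "p \<in> epi" "q \<in> H" for p q
      using that unfolding Q_def by blast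
    have QE: thesis if "z \<in> Q" "\<And>p q. p \<in> epi \<Longrightarrow> q \<in> H \<Longrightarrow> z = (1 - \<theta>) *\<^sub>R p + \<theta> *\<^sub>R q \<Longrightarrow> thesis"
      for z thesis using that unfolding Q_def by blast
    have "convex Q"
    proof -
      have "Q = (\<Union>p\<in>(*\<^sub>R) (1 - \<theta>) ` epi. \<Union>q\<in>(*\<^sub>R) \<theta> ` H. {p + q})"
        unfolding Q_def by blast
      then show ?thesis
        by (simp only:) (intro convex_sums convex_scaling convex_epi Hco)
    qed
    moreover have low: "m \<le> snd p" if "p \<in> epi" for p
      using epi_bound[of "fst p" "snd p"] that by (simp add: m_def)
    have lowQ: "m \<le> r" if "(z, r) \<in> Q" for z r
    proof (rule QE[OF that])
      fix p q assume "p \<in> epi" "q \<in> H" "(z, r) = (1 - \<theta>) *\<^sub>R p + \<theta> *\<^sub>R q"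
      then have "r = (1 - \<theta>) * snd p + \<theta> * snd q" "m \<le> snd p" "m \<le> snd q"
        by (auto simp: H_def dest: low arg_cong[where f = snd])
      then have "r \<ge> (1 - \<theta>) * m + \<theta> * m"
        using \<theta> by (auto intro!: add_mono mult_left_mono)
      then show "m \<le> r" by (simp add: algebra_simps)
    qed
    \<comment> \<open>A sum of unbounded closed sets can fail to be closed. Along a convergent
      sequence the combined heights are at most some \<open>B\<close>, and as both heights are at
      least \<open>m\<close>, each is bounded above by \<open>N\<close>; so the sequence stays in
      the compact set \<open>K\<close>.\<close>
    moreover have "closed Q"
    proof -
      have "l \<in> Q" if s: "\<And>n. s n \<in> Q" "s \<longlonglongrightarrow> l" for s l
      proof -
        have "bounded (range s)" using convergent_imp_bounded s(2) convergentI by blast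
        then obtain B where B: "\<And>n. norm (s n) \<le> B" by (auto simp: bounded_iff)
        define N where "N = max ((B - \<theta> * m) / (1 - \<theta>)) ((B - (1 - \<theta>) * m) / \<theta>)"
        define K where "K = {p + q | p q. p \<in> (*\<^sub>R) (1 - \<theta>) ` (epi \<inter> {p. snd p \<le> N}) \<and>
          q \<in> (*\<^sub>R) \<theta> ` (H \<inter> (epi \<inter> {p. snd p \<le> N}))}"
        have "compact K" unfolding K_def
          by (intro compact_sums compact_scaling compact_epi_truncated closed_Int_compact Hcl)
        moreover have "s n \<in> K" for n
        proof (rule QE[OF s(1)[of n]])
          fix p q assume pq: "p \<in> epi" "q \<in> H" "s n = (1 - \<theta>) *\<^sub>R p + \<theta> *\<^sub>R q"
          then have l: "m \<le> snd p" "m \<le> snd q" "q \<in> epi" by (auto simp: H_def dest: low)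
          have "\<bar>snd (s n)\<bar> \<le> B" using B[of n] norm_snd_le[where x = "fst (s n)" and y = "snd (s n)"] by simp
          then have sB: "(1 - \<theta>) * snd p + \<theta> * snd q \<le> B" using pq by simp
          have "\<theta> * m \<le> \<theta> * snd q" "(1 - \<theta>) * m \<le> (1 - \<theta>) * snd p"
            using l \<theta> by auto
          with sB have "(1 - \<theta>) * snd p \<le> B - \<theta> * m" "\<theta> * snd q \<le> B - (1 - \<theta>) * m"
            by linarith+
          then have "snd p \<le> (B - \<theta> * m) / (1 - \<theta>)" "snd q \<le> (B - (1 - \<theta>) * m) / \<theta>"
            using \<theta> by (auto simp: pos_le_divide_eq mult.commute)
          then have "snd p \<le> N" "snd q \<le> N" by (auto simp: N_def)
          then show "s n \<in> K" using pq l unfolding K_def by blast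
        qed
        ultimately have "l \<in> K"
          using s(2) compact_imp_closed closed_sequentially by blast
        then show "l \<in> Q" unfolding K_def Q_def by blast
      qed
      then show ?thesis by (auto simp: closed_sequential_limits)
    qed
    moreover have "(x, a) \<notin> Q"
    proof
      assume "(x, a) \<in> Q"
      then show False
      proof (rule QE)
        fix p q assume pq: "p \<in> epi" "q \<in> H" "(x, a) = (1 - \<theta>) *\<^sub>R p + \<theta> *\<^sub>R q"
        then have eq: "x = (1 - \<theta>) *\<^sub>R fst p + \<theta> *\<^sub>R fst q" "a = (1 - \<theta>) * snd p + \<theta> * snd q"
          by (auto dest: arg_cong[where f = snd] arg_cong[where f = fst])
        have "fst p \<noteq> fst q"
        proof
          assume "fst p = fst q"
          then have "x = fst q" using eq(1) by (simp add: algebra_simps)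
          then show False using pq(2) t by (simp add: H_def)
        qed
        then have "\<phi> x < ereal a"
          using strictD[of \<theta> "fst p" "snd p" "fst q" "snd q"] pq \<theta> eq by (simp add: H_def epi_def)
        then show False using x by simp
      qed
    qed
    moreover have "(z, r') \<in> Q" if "(z, r) \<in> Q" "r \<le> r'" for z r r'
    proof (rule QE[OF that(1)])
      fix p q assume pq: "p \<in> epi" "q \<in> H" "(z, r) = (1 - \<theta>) *\<^sub>R p + \<theta> *\<^sub>R q"
      have "(fst p, snd p + (r' - r)) \<in> epi" "(fst q, snd q + (r' - r)) \<in> H"
        using pq that(2) by (auto simp: H_def epi_def intro: order_trans)
      from QI[OF this] have "(1 - \<theta>) *\<^sub>R p + \<theta> *\<^sub>R q + (0, r' - r) \<in> Q"
        by (simp add: plus_prod_def algebra_simps scaleR_prod_def)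
      then show "(z, r') \<in> Q" using pq(3)[symmetric] by simp
    qed
    ultimately obtain y b where y: "a < x \<bullet> y - b" "\<And>z r. (z, r) \<in> Q \<Longrightarrow> z \<bullet> y - b \<le> r"
      using exists_affine_minorant_above[of Q m x a] by blast
    have pq: "(1 - \<theta>) * (v \<bullet> y - \<alpha>) + \<theta> * (w \<bullet> y - \<beta>) \<le> b" if "(v, \<alpha>) \<in> epi" "(w, \<beta>) \<in> H" for v \<alpha> w \<beta>
      using y(2)[of "(1 - \<theta>) *\<^sub>R v + \<theta> *\<^sub>R w" "(1 - \<theta>) * \<alpha> + \<theta> * \<beta>"] QI[OF that]
      by (simp add: algebra_simps inner_add_left)
    \<comment> \<open>With \<open>(w, \<beta>)\<close> fixed, the supremum over
      \<open>(v, \<alpha>)\<close> of the first term is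
      \<open>(1 - \<theta>) * \<psi> y\<close>.\<close>
    have le: "(1 - \<theta>) * \<psi> y + \<theta> * (w \<bullet> y - \<beta>) \<le> b" if "(w, \<beta>) \<in> H" for w \<beta>
    proof -
      have "\<psi> y \<le> (b - \<theta> * (w \<bullet> y - \<beta>)) / (1 - \<theta>)"
      proof (rule conjugate_le)
        fix v show "ereal (v \<bullet> y - (b - \<theta> * (w \<bullet> y - \<beta>)) / (1 - \<theta>)) \<le> \<phi> v"
        proof (cases "\<phi> v")
          case (real \<alpha>)
          then have "(1 - \<theta>) * (v \<bullet> y - \<alpha>) \<le> b - \<theta> * (w \<bullet> y - \<beta>)"
            using pq[OF _ that, of v \<alpha>] by (simp add: epi_def)
          then have "v \<bullet> y - \<alpha> \<le> (b - \<theta> * (w \<bullet> y - \<beta>)) / (1 - \<theta>)"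
            using \<theta> by (simp add: pos_le_divide_eq mult.commute)
          then show ?thesis using real by simp
        qed (use not_MInfty in auto)
      qed
      then show ?thesis using \<theta> by (simp add: pos_le_divide_eq mult.commute)
    qed
    show thesis
    \<comment> \<open>The new offset solves
      \<open>\<theta> * b' + (1 - \<theta>) * \<psi> y = b\<close>, so the second conclusion is the
      strict separation of \<open>(x, a)\<close> itself.\<close>
    proof (rule that[of y "(b - (1 - \<theta>) * \<psi> y) / \<theta>"])
      show "\<theta> * ((b - (1 - \<theta>) * \<psi> y) / \<theta>) + (1 - \<theta>) * \<psi> y < x \<bullet> y - a"
        using y(1) \<theta> by simp
      fix w assume w: "t \<le> u \<bullet> w"
      show "ereal (w \<bullet> y - (b - (1 - \<theta>) * \<psi> y) / \<theta>) \<le> \<phi> w"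
      proof (cases "\<phi> w")
        case (real \<beta>)
        then have "\<theta> * (w \<bullet> y - \<beta>) \<le> b - (1 - \<theta>) * \<psi> y"
          using le[of w \<beta>] w by (simp add: H_def epi_def)
        then have "w \<bullet> y - \<beta> \<le> (b - (1 - \<theta>) * \<psi> y) / \<theta>"
          using \<theta> by (simp add: pos_le_divide_eq mult.commute)
        then show ?thesis using real by simp
      qed (use not_MInfty in auto)
    qed
  qed
qed

text \<open>With \<eta> = \<open>\<psi> y - b\<close> the conclusions say that the gap is at least
  \<eta> on the half-space and below \<theta> \<eta> at \<open>x\<close>. The inequality at
  \<open>x\<close> is open in \<open>y\<close>, but the one on the half-space is not, since
  \<open>w\<close> is unbounded. The remedy is to mix it with Young's inequality: a slope within
  \<open>s\<close> of \<open>y\<close> keeps the bound at the price of the offset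
  \<open>(1 - s) * b + s * C\<close>, which tends to \<open>b\<close> as \<open>s\<close> tends to
  0.\<close>

lemma half_space_gap_dense:
  assumes x: "\<phi> x = ereal a" and t: "u \<bullet> x < t" and \<theta>: "0 < \<theta>" "\<theta> < 1"
    and D: "\<And>U. open U \<Longrightarrow> U \<noteq> {} \<Longrightarrow> \<exists>d\<in>D. d \<in> U"
  obtains y b where "y \<in> D" "b \<in> \<rat>" "\<And>w. t \<le> u \<bullet> w \<Longrightarrow> ereal (w \<bullet> y - b) \<le> \<phi> w"
    "\<theta> * b + (1 - \<theta>) * \<psi> y < x \<bullet> y - a"
proof -
  from half_space_gap[OF x t \<theta>] obtain y b where
    y: "\<And>w. t \<le> u \<bullet> w \<Longrightarrow> ereal (w \<bullet> y - b) \<le> \<phi> w" "\<theta> * b + (1 - \<theta>) * \<psi> y < x \<bullet> y - a"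
    by blast
  have "bounded (\<psi> ` cball y 1)"
    by (intro compact_imp_bounded compact_continuous_image continuous_on_subset[OF cont]) auto
  then obtain C where "\<forall>z\<in>cball y 1. \<bar>\<psi> z\<bar> \<le> C"
    by (auto simp: bounded_iff)
  then have C: "\<bar>\<psi> z\<bar> \<le> C" if "z \<in> cball y 1" for z
    using that by blast
  have "((\<lambda>s. \<theta> * ((1 - s) * b + s * C)) \<longlongrightarrow> \<theta> * ((1 - 0) * b + 0 * C)) (at_right 0)"
    by (intro tendsto_intros)
  moreover have "\<theta> * ((1 - 0) * b + 0 * C) < x \<bullet> y - a - (1 - \<theta>) * \<psi> y" using y(2) by simp
  ultimately have "\<forall>\<^sub>F s in at_right 0. \<theta> * ((1 - s) * b + s * C) < x \<bullet> y - a - (1 - \<theta>) * \<psi> y"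
    by (rule order_tendstoD(2))
  moreover have "\<forall>\<^sub>F s::real in at_right 0. 0 < s \<and> s < 1"
    by (auto simp: eventually_at_right_field intro: exI[of _ 1])
  ultimately have "\<forall>\<^sub>F s in at_right 0. 0 < s \<and> s < 1 \<and>
      \<theta> * ((1 - s) * b + s * C) < x \<bullet> y - a - (1 - \<theta>) * \<psi> y"
    by eventually_elim auto
  then obtain s where s: "0 < s" "s < 1" "\<theta> * ((1 - s) * b + s * C) < x \<bullet> y - a - (1 - \<theta>) * \<psi> y"
    by (metis (no_types, lifting) eventually_happens trivial_limit_at_right_real)
  define V where "V = {z. \<theta> * ((1 - s) * b + s * C) < x \<bullet> z - a - (1 - \<theta>) * \<psi> z} \<inter> ball y s"
  have "open V" unfolding V_def
    by (intro open_Int open_Collect_less continuous_intros cont) auto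
  moreover have "y \<in> V" using s by (simp add: V_def)
  ultimately obtain y' where y': "y' \<in> D" "y' \<in> V" using D by blast
  then have y's: "\<theta> * ((1 - s) * b + s * C) < x \<bullet> y' - a - (1 - \<theta>) * \<psi> y'" "norm (y' - y) < s"
    by (auto simp: V_def dist_norm norm_minus_commute)
  have "(1 - s) * b + s * C < (x \<bullet> y' - a - (1 - \<theta>) * \<psi> y') / \<theta>"
    using y's(1) \<theta> by (simp add: pos_less_divide_eq mult.commute)
  then obtain b' where b': "b' \<in> \<rat>" "(1 - s) * b + s * C < b'"
    "b' < (x \<bullet> y' - a - (1 - \<theta>) * \<psi> y') / \<theta>"
    using Rats_dense_in_real by blast
  show thesis
  proof (rule that[OF y'(1) b'(1)])
    show "\<theta> * b' + (1 - \<theta>) * \<psi> y' < x \<bullet> y' - a"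
      using b'(3) \<theta> by (simp add: pos_less_divide_eq mult.commute)
    fix w assume w: "t \<le> u \<bullet> w"
    show "ereal (w \<bullet> y' - b') \<le> \<phi> w"
    proof (cases "\<phi> w")
      case (real \<beta>)
      \<comment> \<open>Chosen so that \<open>y'\<close> is
        \<open>(1 - s) *\<^sub>R y + s *\<^sub>R z\<close>. As \<open>y'\<close> is within
        \<open>s\<close> of \<open>y\<close>, the point \<open>z\<close> lies in the unit ball
        around \<open>y\<close>, where \<psi> is at most \<open>C\<close>.\<close>
      define z where "z = y + (1 / s) *\<^sub>R (y' - y)"
      have "norm (y' - y) / s \<le> 1" using y's(2) s by simp
      then have "z \<in> cball y 1" using s by (simp add: z_def dist_norm)
      then have "w \<bullet> z - C \<le> \<beta>"
        using C[of z] young[of w z] real by auto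
      then have "s * (w \<bullet> z - C) \<le> s * \<beta>" using s by simp
      moreover have "(1 - s) * (w \<bullet> y - b) \<le> (1 - s) * \<beta>"
        using y(1)[OF w] real s by simp
      moreover have "(1 - s) * (w \<bullet> y) + s * (w \<bullet> z) = w \<bullet> y'"
        using s by (simp add: z_def inner_add_right inner_diff_right algebra_simps)
      ultimately have "w \<bullet> y' - ((1 - s) * b + s * C) \<le> \<beta>" by (simp add: algebra_simps)
      then show ?thesis using b'(2) real by simp
    qed (use not_MInfty in auto)
  qed
qed

end

section \<open>Duality and weak compactness in the space of integrable functions\<close>

lemma L1_space_carrierE:
  assumes "F \<in> vcarrier (L1_space M)"
  shows "integrable M (ae_rep F)" "ae_class M (ae_rep F) = F"
proof -
  from assms obtain f where f: "integrable M f" "F = ae_class M f"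
    by (auto simp: L1_space_def)
  note rep = ae_rep_ae_class[of f M]
  have "integrable M (ae_rep F) \<longleftrightarrow> integrable M f"
    using f rep by (intro integrable_cong_AE) auto
  with f show "integrable M (ae_rep F)" by simp
  show "ae_class M (ae_rep F) = F"
    using f rep by (auto intro!: ae_class_eqI)
qed

lemma ae_class_in_L1_space: "integrable M f \<Longrightarrow> ae_class M f \<in> vcarrier (L1_space M)"
  by (auto simp: L1_space_def)

lemma integrable_inner_bounded:
  fixes f g :: "'s \<Rightarrow> 'e::euclidean_space"
  assumes [measurable]: "integrable M f" "g \<in> borel_measurable M" and C: "\<And>s. norm (g s) \<le> C"
  shows "integrable M (\<lambda>s. f s \<bullet> g s)"
proof (rule Bochner_Integration.integrable_bound)
  show "integrable M (\<lambda>s. C * norm (f s))" using assms(1) by auto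
  show "AE s in M. norm (f s \<bullet> g s) \<le> norm (C * norm (f s))"
  proof (rule AE_I2)
    fix s
    have "\<bar>f s \<bullet> g s\<bar> \<le> norm (f s) * norm (g s)" by (rule Cauchy_Schwarz_ineq2)
    also have "\<dots> \<le> norm (f s) * C" by (intro mult_left_mono C) auto
    also have "\<dots> \<le> norm (C * norm (f s))" by (simp add: mult.commute)
    finally show "norm (f s \<bullet> g s) \<le> norm (C * norm (f s))" by simp
  qed
qed measurable

definition pairing :: "'s measure \<Rightarrow> ('s \<Rightarrow> 'e::euclidean_space) \<Rightarrow> ('s \<Rightarrow> 'e) set \<Rightarrow> real" where
  "pairing M g F = (LINT s|M. ae_rep F s \<bullet> g s)"

lemma pairing_ae_class:
  assumes [measurable]: "f \<in> borel_measurable M" "g \<in> borel_measurable M"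
  shows "pairing M g (ae_class M f) = (LINT s|M. f s \<bullet> g s)"
  unfolding pairing_def
  using ae_rep_ae_class[OF assms(1)] by (intro integral_cong_AE) (auto elim!: eventually_mono)

lemma pairing_in_dual:
  fixes g :: "'s \<Rightarrow> 'e::euclidean_space"
  assumes [measurable]: "g \<in> borel_measurable M" and C: "\<And>s. norm (g s) \<le> C"
  shows "pairing M g \<in> dual_functionals (L1_space M)"
proof -
  note int = integrable_inner_bounded[OF _ assms]
  have add: "pairing M g (vadd (L1_space M) (ae_class M f) (ae_class M h)) =
      pairing M g (ae_class M f) + pairing M g (ae_class M h)"
    if [measurable]: "integrable M f" "integrable M h" for f h
    using that int[of f] int[of h] by (simp add: L1_space_ae_class pairing_ae_class inner_add_left)
  have scale: "pairing M g (vscale (L1_space M) c (ae_class M f)) = c * pairing M g (ae_class M f)"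
    if [measurable]: "integrable M f" for f c
    using that int[of f] by (simp add: L1_space_ae_class pairing_ae_class)
  have bound: "\<bar>pairing M g (ae_class M f)\<bar> \<le> C * vnorm (L1_space M) (ae_class M f)"
    if [measurable]: "integrable M f" for f
  proof -
    have "\<bar>LINT s|M. f s \<bullet> g s\<bar> \<le> (LINT s|M. \<bar>f s \<bullet> g s\<bar>)" by (rule integral_abs_bound)
    also have "\<dots> \<le> (LINT s|M. C * norm (f s))"
    proof (intro integral_mono)
      show "\<bar>f s \<bullet> g s\<bar> \<le> C * norm (f s)" for s
        using Cauchy_Schwarz_ineq2[of "f s" "g s"] mult_left_mono[OF C[of s], of "norm (f s)"]
        by (simp add: mult.commute)
    qed (use that int[of f] in auto)
    finally show ?thesis using that by (simp add: L1_space_ae_class pairing_ae_class)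
  qed
  show ?thesis
    unfolding dual_functionals_def
  proof (intro CollectI conjI ballI allI exI)
    fix F G :: "('s \<Rightarrow> 'e) set"
    assume F: "F \<in> vcarrier (L1_space M)" and G: "G \<in> vcarrier (L1_space M)"
    note F = L1_space_carrierE[OF F] and G = L1_space_carrierE[OF G]
    show "pairing M g (vadd (L1_space M) F G) = pairing M g F + pairing M g G"
      using add[OF F(1) G(1)] F G by simp
  next
    fix F :: "('s \<Rightarrow> 'e) set" and c :: real
    assume F: "F \<in> vcarrier (L1_space M)"
    note F = L1_space_carrierE[OF F]
    show "pairing M g (vscale (L1_space M) c F) = c * pairing M g F"
      using scale[OF F(1)] F by simp
    show "\<bar>pairing M g F\<bar> \<le> C * vnorm (L1_space M) F"
      using bound[OF F(1)] F by simp
  qed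
qed

section \<open>Continuity into and out of the weak topology\<close>

lemma dual_functionals_add:
  "\<Lambda> \<in> dual_functionals X \<Longrightarrow> x \<in> vcarrier X \<Longrightarrow> y \<in> vcarrier X \<Longrightarrow> \<Lambda> (vadd X x y) = \<Lambda> x + \<Lambda> y"
  by (auto simp: dual_functionals_def)

lemma dual_functionals_scale:
  "\<Lambda> \<in> dual_functionals X \<Longrightarrow> x \<in> vcarrier X \<Longrightarrow> \<Lambda> (vscale X c x) = c * \<Lambda> x"
  by (auto simp: dual_functionals_def)

lemma continuous_map_weak_topology_dual:
  assumes "\<Lambda> \<in> dual_functionals X"
  shows "continuous_map (weak_topology X) euclideanreal \<Lambda>"
  unfolding continuous_map_def
proof (intro conjI allI impI)
  fix U :: "real set" assume "openin euclideanreal U"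
  then have "{x \<in> vcarrier X. \<Lambda> x \<in> U} \<in> {{x \<in> vcarrier X. \<Lambda> x \<in> U} | \<Lambda> U. \<Lambda> \<in> dual_functionals X \<and> open U}"
    using assms by auto
  then show "openin (weak_topology X) {x \<in> topspace (weak_topology X). \<Lambda> x \<in> U}"
    unfolding topspace_weak_topology unfolding weak_topology_def by (rule topology_generated_by_Basis)
qed auto

text \<open>Universal property of a generated topology: preimages of the generating sets
  suffice.\<close>

lemma continuous_map_into_weak_topology:
  assumes "\<And>x. x \<in> topspace T \<Longrightarrow> f x \<in> vcarrier X"
    and "\<And>\<Lambda>. \<Lambda> \<in> dual_functionals X \<Longrightarrow> continuous_map T euclideanreal (\<lambda>x. \<Lambda> (f x))"
  shows "continuous_map T (weak_topology X) f"
  unfolding weak_topology_def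
proof (rule continuous_on_generated_topo)
  fix U assume "U \<in> {{x \<in> vcarrier X. \<Lambda> x \<in> U} | \<Lambda> U. \<Lambda> \<in> dual_functionals X \<and> open U}"
  then obtain \<Lambda> V where U: "U = {x \<in> vcarrier X. \<Lambda> x \<in> V}" "\<Lambda> \<in> dual_functionals X" "open V"
    by blast
  then have "openin T {x \<in> topspace T. \<Lambda> (f x) \<in> V}"
    using assms(2) by (auto simp: continuous_map_def)
  moreover have "{x \<in> topspace T. \<Lambda> (f x) \<in> V} = f -` U \<inter> topspace T"
    using assms(1) U by auto
  ultimately show "openin T (f -` U \<inter> topspace T)" by simp
next
  show "f ` topspace T \<subseteq> \<Union> {{x \<in> vcarrier X. \<Lambda> x \<in> U} | \<Lambda> U. \<Lambda> \<in> dual_functionals X \<and> open U}"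
    using assms(1) topspace_weak_topology[of X]
    unfolding weak_topology_def topology_generated_by_topspace by blast
qed

lemma limitin_weak_topologyD:
  assumes "limitin (weak_topology X) xs x F" "\<Lambda> \<in> dual_functionals X"
  shows "((\<lambda>n. \<Lambda> (xs n)) \<longlongrightarrow> \<Lambda> x) F"
  using continuous_map_limit[OF continuous_map_weak_topology_dual[OF assms(2)] assms(1)]
  by (simp add: o_def)

section \<open>Densities, the dual of L1, and the Dunford-Pettis criterion\<close>

context finite_measure
begin

text \<open>Hypothesis \<open>ac\<close> does double duty: it gives continuity from above at the
  empty set, hence countable additivity, and it gives absolute continuity, so Radon-Nikodym applies.
  In the form \<open>e + K * measure M A\<close> it is a non-strict inequality for each single set,
  and therefore passes to pointwise limits of set functions.\<close>

lemma density_of_additive: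
  fixes q :: "'a set \<Rightarrow> real"
  assumes nn: "\<And>A. A \<in> sets M \<Longrightarrow> 0 \<le> q A"
    and add: "\<And>A B. A \<in> sets M \<Longrightarrow> B \<in> sets M \<Longrightarrow> A \<inter> B = {} \<Longrightarrow> q (A \<union> B) = q A + q B"
    and ac: "\<And>e. 0 < e \<Longrightarrow> \<exists>K. \<forall>A\<in>sets M. q A \<le> e + K * measure M A"
  obtains h where "integrable M h" "\<And>s. 0 \<le> h s" "\<And>A. A \<in> sets M \<Longrightarrow> (LINT s:A|M. h s) = q A"
proof -
  define N where "N = measure_of (space M) (sets M) (\<lambda>A. ennreal (q A))"
  have q0: "q {} = 0" using add[of "{}" "{}"] by simp
  have pos: "positive (sets M) (\<lambda>A. ennreal (q A))" by (simp add: positive_def q0)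
  have ca: "countably_additive (sets M) (\<lambda>A. ennreal (q A))"
  proof (rule sets.empty_continuous_imp_countably_additive[OF pos])
    show "additive (sets M) (\<lambda>A. ennreal (q A))"
      unfolding additive_def using add nn by (simp add: ennreal_plus[symmetric] del: ennreal_plus)
    fix A :: "nat \<Rightarrow> 'a set" assume A: "range A \<subseteq> sets M" "decseq A" "(\<Inter>i. A i) = {}"
    have lim: "(\<lambda>i. measure M (A i)) \<longlonglongrightarrow> 0"
      using finite_Lim_measure_decseq[OF A(1,2)] A(3) by simp
    have "(\<lambda>i. q (A i)) \<longlonglongrightarrow> 0"
    proof (rule order_tendstoI)
      fix a :: real assume "a < 0"
      moreover have "0 \<le> q (A i)" for i using nn A(1) by auto
      ultimately show "\<forall>\<^sub>F i in sequentially. a < q (A i)"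
        by (intro always_eventually allI) (rule less_le_trans)
    next
      fix a :: real assume a: "0 < a"
      then obtain K where K: "\<forall>A\<in>sets M. q A \<le> a / 2 + K * measure M A" using ac[of "a / 2"] by auto
      have "(\<lambda>i. a / 2 + K * measure M (A i)) \<longlonglongrightarrow> a / 2 + K * 0"
        by (intro tendsto_intros lim)
      then have "\<forall>\<^sub>F i in sequentially. a / 2 + K * measure M (A i) < a"
        using a by (intro order_tendstoD(2)[where y = "a / 2 + K * 0"]) auto
      then show "\<forall>\<^sub>F i in sequentially. q (A i) < a"
      proof (rule eventually_mono)
        fix i assume "a / 2 + K * measure M (A i) < a"
        moreover have "q (A i) \<le> a / 2 + K * measure M (A i)" using K A(1) by auto
        ultimately show "q (A i) < a" by linarith
      qed
    qed
    then have "(\<lambda>i. ennreal (q (A i))) \<longlonglongrightarrow> ennreal 0" by (rule tendsto_ennrealI)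
    then show "(\<lambda>i. ennreal (q (A i))) \<longlonglongrightarrow> 0" by simp
  qed auto
  have em: "emeasure N A = ennreal (q A)" if "A \<in> sets M" for A
    unfolding N_def
    by (rule emeasure_measure_of_sigma[OF sets.sigma_algebra_axioms pos ca that])
  have setsN: "sets N = sets M" by (simp add: N_def sets.sets_measure_of_eq)
  have "absolutely_continuous M N"
  proof -
    have "q A = 0" if "A \<in> sets M" "emeasure M A = 0" for A
    proof -
      have "q A \<le> 0"
      proof (rule field_le_epsilon)
        fix e :: real assume "0 < e"
        from ac[OF this] obtain K where "\<forall>A\<in>sets M. q A \<le> e + K * measure M A" ..
        moreover have "measure M A = 0" using that(2) by (simp add: measure_def)
        ultimately show "q A \<le> 0 + e" using that(1) by fastforce
      qed
      with nn[OF that(1)] show ?thesis by linarith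
    qed
    then have "A \<in> null_sets N" if "A \<in> null_sets M" for A
      using that em[of A] by (simp add: null_sets_def setsN)
    then show ?thesis
      unfolding absolutely_continuous_def by blast
  qed
  from Radon_Nikodym[OF this setsN] obtain f where
    f [measurable]: "f \<in> borel_measurable M" and N: "density M f = N" by blast
  have nf: "(\<integral>\<^sup>+s. f s * indicator A s \<partial>M) = ennreal (q A)" if "A \<in> sets M" for A
  proof -
    have "emeasure (density M f) A = ennreal (q A)" unfolding N by (rule em[OF that])
    then show ?thesis unfolding emeasure_density[OF f that] .
  qed
  have "(\<integral>\<^sup>+s. f s \<partial>M) = ennreal (q (space M))"
  proof -
    have "(\<integral>\<^sup>+s. f s \<partial>M) = (\<integral>\<^sup>+s. f s * indicator (space M) s \<partial>M)"
      by (rule nn_integral_cong) simp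
    also have "\<dots> = ennreal (q (space M))" by (rule nf) simp
    finally show ?thesis .
  qed
  then have fin: "AE s in M. f s \<noteq> \<infinity>"
    by (intro nn_integral_noteq_infinite) auto
  have nh: "(\<integral>\<^sup>+s. ennreal (indicator A s * enn2real (f s)) \<partial>M) = ennreal (q A)" if "A \<in> sets M" for A
  proof -
    have "(\<integral>\<^sup>+s. ennreal (indicator A s * enn2real (f s)) \<partial>M) = (\<integral>\<^sup>+s. f s * indicator A s \<partial>M)"
      using fin by (intro nn_integral_cong_AE, eventually_elim)
        (auto simp: less_top[symmetric] split: split_indicator)
    then show ?thesis using nf[OF that] by simp
  qed
  show thesis
  proof (rule that[of "\<lambda>s. enn2real (f s)"])
    have "(\<integral>\<^sup>+s. ennreal (enn2real (f s)) \<partial>M) = ennreal (q (space M))"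
    proof -
      have "(\<integral>\<^sup>+s. ennreal (enn2real (f s)) \<partial>M) =
        (\<integral>\<^sup>+s. ennreal (indicator (space M) s * enn2real (f s)) \<partial>M)"
        by (rule nn_integral_cong) simp
      also have "\<dots> = ennreal (q (space M))" by (rule nh) simp
      finally show ?thesis .
    qed
    then show "integrable M (\<lambda>s. enn2real (f s))"
      by (intro integrableI_nonneg) auto
    fix A assume A [measurable]: "A \<in> sets M"
    have "(LINT s|M. indicator A s * enn2real (f s)) = enn2real (ennreal (q A))"
      unfolding nh[OF A, symmetric] by (intro integral_eq_nn_integral) auto
    then show "(LINT s:A|M. enn2real (f s)) = q A"
      using nn[OF A] by (simp add: set_lebesgue_integral_def)
  qed auto
qed

text \<open>Rounding \<open>g\<close> down to multiples of \<open>1 / Suc n\<close> leaves finitely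
  many values, so the integral becomes a finite combination of integrals over sets, continuous by
  \<open>cont\<close>. The common bound \<open>B\<close> makes the rounding error uniform in
  \<open>p\<close>, and uniform limits keep continuity.\<close>

lemma continuous_on_integral_mult_bounded:
  fixes h :: "'p::topological_space \<Rightarrow> 'a \<Rightarrow> real"
  assumes int: "\<And>p. p \<in> P \<Longrightarrow> integrable M (h p)"
    and nn: "\<And>p s. p \<in> P \<Longrightarrow> 0 \<le> h p s"
    and B: "\<And>p. p \<in> P \<Longrightarrow> (LINT s|M. h p s) \<le> B"
    and cont: "\<And>A. A \<in> sets M \<Longrightarrow> continuous_on P (\<lambda>p. LINT s:A|M. h p s)"
    and g [measurable]: "g \<in> borel_measurable M" and C: "\<And>s. \<bar>g s\<bar> \<le> C"
  shows "continuous_on P (\<lambda>p. LINT s|M. h p s * g s)"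
proof -
  define r where "r n s = real_of_int \<lfloor>real (Suc n) * g s\<rfloor> / real (Suc n)" for n s
  have [measurable]: "r n \<in> borel_measurable M" for n unfolding r_def by measurable
  have close: "\<bar>r n s - g s\<bar> \<le> 1 / real (Suc n)" for n s
  proof -
    define x where "x = real (Suc n) * g s"
    have "\<bar>of_int \<lfloor>x\<rfloor> - x\<bar> \<le> 1" by linarith
    moreover have "r n s - g s = (of_int \<lfloor>x\<rfloor> - x) / real (Suc n)"
      by (simp add: r_def x_def field_simps)
    ultimately show ?thesis by (simp add: abs_divide divide_right_mono del: of_nat_Suc)
  qed
  have rC: "\<bar>r n s\<bar> \<le> C + 1" for n s
  proof -
    have "1 / real (Suc n) \<le> 1" by simp
    then show ?thesis using close[of n s] C[of s] by linarith
  qed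
  have intm: "integrable M (\<lambda>s. h p s * k s)" if "p \<in> P" and [measurable]: "k \<in> borel_measurable M"
    and "\<And>s. \<bar>k s\<bar> \<le> D" for p k D
    using integrable_inner_bounded[OF int[OF that(1)] that(2), of D] that(3) by simp
  have cr: "continuous_on P (\<lambda>p. LINT s|M. h p s * r n s)" for n
  proof -
    define Z where "Z = \<lceil>real (Suc n) * C\<rceil> + 1"
    define A where "A k = {s \<in> space M. \<lfloor>real (Suc n) * g s\<rfloor> = k}" for k
    have [measurable]: "A k \<in> sets M" for k unfolding A_def by measurable
    have in_range: "\<lfloor>real (Suc n) * g s\<rfloor> \<in> {-Z..Z}" for s
    proof -
      have "\<bar>real (Suc n) * g s\<bar> \<le> real (Suc n) * C"
        unfolding abs_mult using C[of s] by (simp add: mult_left_mono del: of_nat_Suc)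
      then show ?thesis unfolding Z_def by (simp del: of_nat_Suc) linarith
    qed
    have r_eq: "h p s * r n s = (\<Sum>k\<in>{-Z..Z}. (of_int k / real (Suc n)) * (indicator (A k) s * h p s))"
      if "s \<in> space M" for p s
    proof -
      have "(\<Sum>k\<in>{-Z..Z}. (of_int k / real (Suc n)) * (indicator (A k) s * h p s)) =
        (\<Sum>k\<in>{-Z..Z}. if k = \<lfloor>real (Suc n) * g s\<rfloor> then (of_int k / real (Suc n)) * h p s else 0)"
        using that by (intro sum.cong) (auto simp: A_def indicator_def)
      also have "\<dots> = r n s * h p s" using in_range[of s] by (subst sum.delta) (auto simp: r_def)
      finally show ?thesis by simp
    qed
    have "(LINT s|M. h p s * r n s) = (\<Sum>k\<in>{-Z..Z}. (of_int k / real (Suc n)) * (LINT s:A k|M. h p s))"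
      if "p \<in> P" for p
    proof -
      have ik: "integrable M (\<lambda>s. indicator (A k) s * h p s)" for k
        using integrable_mult_indicator[OF _ int[OF that], of "A k"] by simp
      have "(LINT s|M. h p s * r n s) =
        (LINT s|M. (\<Sum>k\<in>{-Z..Z}. (of_int k / real (Suc n)) * (indicator (A k) s * h p s)))"
        by (intro Bochner_Integration.integral_cong refl r_eq)
      also have "\<dots> = (\<Sum>k\<in>{-Z..Z}. LINT s|M. (of_int k / real (Suc n)) * (indicator (A k) s * h p s))"
        by (intro Bochner_Integration.integral_sum integrable_mult_right ik)
      finally show ?thesis by (simp add: set_lebesgue_integral_def)
    qed
    moreover have "continuous_on P (\<lambda>p. \<Sum>k\<in>{-Z..Z}. (of_int k / real (Suc n)) * (LINT s:A k|M. h p s))"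
      by (intro continuous_intros cont) auto
    ultimately show ?thesis by (simp cong: continuous_on_cong)
  qed
  show ?thesis
  proof (rule uniform_limit_theorem)
    show "\<forall>\<^sub>F n in sequentially. continuous_on P (\<lambda>p. LINT s|M. h p s * r n s)"
      using cr by simp
    show "uniform_limit P (\<lambda>n p. LINT s|M. h p s * r n s) (\<lambda>p. LINT s|M. h p s * g s) sequentially"
    proof (rule uniform_limitI)
      fix e :: real assume "0 < e"
      then have "\<forall>\<^sub>F n in sequentially. \<bar>B\<bar> * inverse (real (Suc n)) < e"
        using tendsto_mult_right_zero[OF LIMSEQ_inverse_real_of_nat, of "\<bar>B\<bar>"] order_tendstoD(2) by blast
      then show "\<forall>\<^sub>F n in sequentially. \<forall>p\<in>P.
          dist (LINT s|M. h p s * r n s) (LINT s|M. h p s * g s) < e"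
      proof (rule eventually_mono, intro ballI)
        fix n p assume n: "\<bar>B\<bar> * inverse (real (Suc n)) < e" and p: "p \<in> P"
        have i: "integrable M (\<lambda>s. h p s * r n s)" "integrable M (\<lambda>s. h p s * g s)"
          by (rule intm[OF p _ rC], measurable) (rule intm[OF p g C])
        have "\<bar>(LINT s|M. h p s * r n s) - (LINT s|M. h p s * g s)\<bar> =
            \<bar>LINT s|M. h p s * r n s - h p s * g s\<bar>"
          using i by simp
        also have "\<dots> \<le> (LINT s|M. \<bar>h p s * r n s - h p s * g s\<bar>)" by (rule integral_abs_bound)
        also have "\<dots> \<le> (LINT s|M. h p s * inverse (real (Suc n)))"
        proof (rule integral_mono)
          show "\<bar>h p s * r n s - h p s * g s\<bar> \<le> h p s * inverse (real (Suc n))" for s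
            unfolding right_diff_distrib[symmetric] abs_mult
            using nn[OF p, of s] mult_left_mono[OF close[of n s] nn[OF p, of s]]
            by (simp add: inverse_eq_divide del: of_nat_Suc)
        qed (use i int[OF p] in auto)
        also have "\<dots> = (LINT s|M. h p s) * inverse (real (Suc n))" by simp
        also have "\<dots> \<le> \<bar>B\<bar> * inverse (real (Suc n))"
          using B[OF p] by (intro mult_right_mono) auto
        also note n
        finally show "dist (LINT s|M. h p s * r n s) (LINT s|M. h p s * g s) < e"
          by (simp add: dist_real_def)
      qed
    qed
  qed simp
qed

text \<open>The weak topology is generated by all abstract bounded functionals, so weak continuity
  of a map into L1 can be checked by integrals only once every functional is known to be one. The
  representing function is built coordinatewise from the values on
  \<open>indicat_real A s *\<^sub>R i\<close>.\<close>

lemma L1_dual_representation: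
  fixes \<Lambda> :: "('a \<Rightarrow> 'e::euclidean_space) set \<Rightarrow> real"
  assumes "\<Lambda> \<in> dual_functionals (L1_space M)"
  obtains g C where "g \<in> borel_measurable M" "\<And>s. norm (g s) \<le> C"
    "\<And>f. integrable M f \<Longrightarrow> \<Lambda> (ae_class M f) = (LINT s|M. f s \<bullet> g s)"
proof -
  define l where "l f = \<Lambda> (ae_class M f)" for f
  from assms obtain C0 where C0: "\<forall>F\<in>vcarrier (L1_space M). \<bar>\<Lambda> F\<bar> \<le> C0 * vnorm (L1_space M) F"
    by (auto simp: dual_functionals_def)
  define C where "C = \<bar>C0\<bar>"
  have C: "C \<ge> 0" by (simp add: C_def)
  have add: "l (\<lambda>s. f s + g s) = l f + l g" if "integrable M f" "integrable M g" for f g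
    unfolding l_def L1_space_ae_class(1)[OF that, symmetric]
    by (intro dual_functionals_add[OF assms] ae_class_in_L1_space that)
  have scale: "l (\<lambda>s. c *\<^sub>R f s) = c * l f" if "integrable M f" for f c
    unfolding l_def L1_space_ae_class(2)[OF that that, symmetric]
    by (intro dual_functionals_scale[OF assms] ae_class_in_L1_space that)
  have bound: "\<bar>l f\<bar> \<le> C * (LINT s|M. norm (f s))" if "integrable M f" for f
  proof -
    have "\<bar>l f\<bar> \<le> C0 * (LINT s|M. norm (f s))"
      using C0 L1_space_ae_class(3)[OF that that] ae_class_in_L1_space[OF that] by (auto simp: l_def)
    also have "\<dots> \<le> C * (LINT s|M. norm (f s))"
      unfolding C_def by (intro mult_right_mono) auto
    finally show ?thesis .
  qed
  have diff: "l f - l g = l (\<lambda>s. f s - g s)" if "integrable M f" "integrable M g" for f g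
    using add[OF that(1), of "\<lambda>s. (-1) *\<^sub>R g s"] scale[OF that(2), of "-1"] that by simp
  have sum: "l (\<lambda>s. \<Sum>i\<in>I. f i s) = (\<Sum>i\<in>I. l (f i))"
    if "finite I" "\<And>i. i \<in> I \<Longrightarrow> integrable M (f i)" for I :: "'e set" and f
    using that
  proof (induction I rule: finite_induct)
    case empty
    show ?case using scale[of "\<lambda>_. 0" 0] by simp
  next
    case (insert i I)
    then show ?case by (simp add: add)
  qed
  have ind: "integrable M (\<lambda>s. indicat_real A s *\<^sub>R c)" if "A \<in> sets M" for A and c :: 'e
    using that by (intro integrable_scaleR_left integrable_real_indicator) (simp_all add: less_top[symmetric])
  \<comment> \<open>The set function given by \<open>l\<close> is signed but bounded by
    \<open>C * measure M A\<close>; adding that bound makes it nonnegative, and at most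
    \<open>2 * C * measure M A\<close>, as \<open>density_of_additive\<close> wants.\<close>
  define q where "q i A = l (\<lambda>s. indicat_real A s *\<^sub>R i) + C * measure M A" for i A
  have lb: "\<bar>l (\<lambda>s. indicat_real A s *\<^sub>R i)\<bar> \<le> C * measure M A" if "i \<in> Basis" "A \<in> sets M" for i A
    using bound[OF ind[OF that(2)], of i] that by simp
  have "\<exists>h. integrable M h \<and> (\<forall>A\<in>sets M. (LINT s:A|M. h s) = q i A)" if i: "i \<in> Basis" for i
  proof -
    have "0 \<le> q i A" if "A \<in> sets M" for A
      using lb[OF i that] by (simp add: q_def)
    moreover have "q i (A \<union> B) = q i A + q i B" if "A \<in> sets M" "B \<in> sets M" "A \<inter> B = {}" for A B
    proof -
      have "(\<lambda>s. indicat_real (A \<union> B) s *\<^sub>R i) = (\<lambda>s. indicat_real A s *\<^sub>R i + indicat_real B s *\<^sub>R i)"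
        using that(3) by (intro ext) (auto split: split_indicator)
      then show ?thesis
        using add[OF ind[OF that(1)] ind[OF that(2)]] that
        by (simp add: q_def finite_measure_Union algebra_simps)
    qed
    moreover have "\<exists>K. \<forall>A\<in>sets M. q i A \<le> e + K * measure M A" if "0 < e" for e
      using lb[OF i] that by (intro exI[of _ "2 * C"]) (force simp: q_def)
    ultimately show ?thesis by (rule density_of_additive[of "q i"]) auto
  qed
  then obtain h where h: "\<And>i. i \<in> Basis \<Longrightarrow> integrable M (h i)"
    "\<And>i A. i \<in> Basis \<Longrightarrow> A \<in> sets M \<Longrightarrow> (LINT s:A|M. h i s) = q i A"
    by metis
  \<comment> \<open>Undoes the shift by \<open>C\<close>. The averaging theorem puts
    \<open>h i\<close> in \<open>{0..2 * C}\<close> only almost everywhere; clipping changes a null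
    set and gives a bound at every point.\<close>
  define k where "k i s = max (- C) (min C (h i s - C))" for i s
  have kC: "\<bar>k i s\<bar> \<le> C" for i s using C by (auto simp: k_def)
  have km [measurable]: "k i \<in> borel_measurable M" if "i \<in> Basis" for i
    using h(1)[OF that] unfolding k_def by measurable
  have k: "(LINT s:A|M. k i s) = l (\<lambda>s. indicat_real A s *\<^sub>R i)" if i: "i \<in> Basis" and A: "A \<in> sets M" for i A
  proof -
    note [measurable] = A h(1)[OF i]
    have "AE s in M. h i s \<in> {0..2 * C}"
    proof (rule averaging_theorem[OF h(1)[OF i]])
      fix A assume A: "A \<in> sets M" "measure M A > 0"
      have "0 \<le> q i A" "q i A \<le> 2 * C * measure M A"
        using lb[OF i A(1)] by (auto simp: q_def)
      then show "(1 / measure M A) *\<^sub>R (LINT s:A|M. h i s) \<in> {0..2 * C}"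
        using A h(2)[OF i] by (simp add: divide_le_eq)
    qed auto
    then have "AE s in M. k i s = h i s - C"
      by eventually_elim (auto simp: k_def)
    then have "(LINT s:A|M. k i s) = (LINT s:A|M. h i s - C)"
      using i by (intro set_lebesgue_integral_cong_AE) auto
    also have "\<dots> = q i A - C * measure M A"
    proof -
      have "integrable M (\<lambda>s. indicat_real A s * h i s)" "integrable M (indicat_real A)"
        using integrable_mult_indicator[OF A h(1)[OF i]] A
        by (simp_all add: less_top[symmetric] integrable_real_indicator)
      then show ?thesis
        using h(2)[OF i A] A by (simp add: set_lebesgue_integral_def right_diff_distrib)
    qed
    finally show ?thesis by (simp add: q_def)
  qed
  define g where "g s = (\<Sum>i\<in>Basis. k i s *\<^sub>R i)" for s
  have gm [measurable]: "g \<in> borel_measurable M" unfolding g_def by measurable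
  have gC: "norm (g s) \<le> (\<Sum>i\<in>(Basis::'e set). C)" for s
    unfolding g_def by (intro order_trans[OF norm_sum] sum_mono) (simp add: kC)
  note ig = integrable_inner_bounded[OF _ gm gC]
  have "l f = (LINT s|M. f s \<bullet> g s)" if "integrable M f" for f
    using that
  proof (induction f rule: integrable_induct)
    case (base A c)
    have "(\<lambda>s. indicat_real A s *\<^sub>R c) = (\<lambda>s. \<Sum>i\<in>Basis. (c \<bullet> i) *\<^sub>R (indicat_real A s *\<^sub>R i))"
      by (subst euclidean_representation[of c, symmetric]) (simp add: scaleR_sum_right mult.commute)
    then have "l (\<lambda>s. indicat_real A s *\<^sub>R c) = (\<Sum>i\<in>Basis. (c \<bullet> i) * (LINT s:A|M. k i s))"
      using base by (simp only:) (subst sum, auto simp: scale k simp del: scaleR_scaleR)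
    also have "\<dots> = (\<Sum>i\<in>Basis. LINT s|M. (c \<bullet> i) * (indicat_real A s * k i s))"
      by (simp add: set_lebesgue_integral_def)
    also have "\<dots> = (LINT s|M. (\<Sum>i\<in>Basis. (c \<bullet> i) * (indicat_real A s * k i s)))"
    proof (rule Bochner_Integration.integral_sum[symmetric])
      fix i :: 'e assume i: "i \<in> Basis"
      have "integrable M (k i)"
        using km[OF i] kC by (intro integrable_const_bound[of _ C]) auto
      from integrable_mult_indicator[OF _ this, of A] base
      show "integrable M (\<lambda>s. (c \<bullet> i) * (indicat_real A s * k i s))" by simp
    qed
    also have "\<dots> = (LINT s|M. (indicat_real A s *\<^sub>R c) \<bullet> g s)"
      by (simp add: g_def inner_sum_right sum_distrib_left mult_ac)
    finally show ?case .
  next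
    case (add f f')
    then show ?case
      using ig[of f] ig[of f'] \<open>\<And>f g. integrable M f \<Longrightarrow> integrable M g \<Longrightarrow> l (\<lambda>s. f s + g s) = l f + l g\<close>
      by (simp add: inner_add_left)
  next
    \<comment> \<open>Both sides are continuous along dominated approximations: the left by the norm
      bound on \<open>l\<close>, the right by dominated convergence.\<close>
    case (lim f t)
    have [measurable]: "f \<in> borel_measurable M" "t n \<in> borel_measurable M" for n
      using lim by auto
    have "(\<lambda>n. LINT s|M. norm (t n s - f s)) \<longlonglongrightarrow> (LINT s|M. norm (0::'e))"
    proof (rule integral_dominated_convergence[where w = "\<lambda>s. 3 * norm (f s)"])
      show "AE s in M. (\<lambda>n. norm (t n s - f s)) \<longlonglongrightarrow> norm (0::'e)"
        using lim.hyps(2) by (intro AE_I2 tendsto_norm) (simp add: LIM_zero)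
      show "AE s in M. norm (norm (t n s - f s)) \<le> 3 * norm (f s)" for n
      proof (rule AE_I2)
        fix s assume "s \<in> space M"
        then show "norm (norm (t n s - f s)) \<le> 3 * norm (f s)"
          using lim.hyps(3)[of s n] norm_triangle_ineq4[of "t n s" "f s"] by simp
      qed
    qed (use lim in auto)
    then have z: "(\<lambda>n. C * (LINT s|M. norm (t n s - f s))) \<longlonglongrightarrow> 0"
      using tendsto_mult_right_zero by fastforce
    have "(\<lambda>n. l (t n) - l f) \<longlonglongrightarrow> 0"
    proof (rule Lim_null_comparison[OF always_eventually z], intro allI)
      show "norm (l (t n) - l f) \<le> C * (LINT s|M. norm (t n s - f s))" for n
        using bound[of "\<lambda>s. t n s - f s"] diff[of "t n" f] lim by simp
    qed
    then have "(\<lambda>n. l (t n)) \<longlonglongrightarrow> l f" by (rule LIM_zero_cancel)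
    moreover have "(\<lambda>n. LINT s|M. t n s \<bullet> g s) \<longlonglongrightarrow> (LINT s|M. f s \<bullet> g s)"
    proof (rule integral_dominated_convergence[where w = "\<lambda>s. 2 * norm (f s) * (\<Sum>i\<in>(Basis::'e set). C)"])
      show "AE s in M. (\<lambda>n. t n s \<bullet> g s) \<longlonglongrightarrow> f s \<bullet> g s"
        using lim.hyps(2) by (intro AE_I2 tendsto_inner tendsto_const)
      show "AE s in M. norm (t n s \<bullet> g s) \<le> 2 * norm (f s) * (\<Sum>i\<in>(Basis::'e set). C)" for n
      proof (rule AE_I2)
        fix s assume s: "s \<in> space M"
        have "norm (t n s \<bullet> g s) \<le> norm (t n s) * norm (g s)" by (simp add: Cauchy_Schwarz_ineq2)
        also have "\<dots> \<le> 2 * norm (f s) * (\<Sum>i\<in>(Basis::'e set). C)"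
          using lim.hyps(3)[OF s, of n] gC[of s] by (intro mult_mono) auto
        finally show "norm (t n s \<bullet> g s) \<le> 2 * norm (f s) * (\<Sum>i\<in>(Basis::'e set). C)" .
      qed
    qed (use lim in auto)
    ultimately show ?case using lim.IH LIMSEQ_unique by auto
  qed
  then show thesis using gC gm by (intro that) (auto simp: l_def)
qed

text \<open>
  The integrals of \<open>max 0 (f \<bullet> u)\<close> over all measurable sets embed \<open>L\<close> into a compact product of
  intervals. Uniform integrability makes every point of the closure of the image a family of
  absolutely continuous positive measures, whose densities recombine to an integrable function.
\<close>

theorem compactin_weak_topology_L1:
  fixes L :: "('a \<Rightarrow> 'e::euclidean_space) set set"
  assumes sub: "L \<subseteq> vcarrier (L1_space M)"
    and ui: "\<And>e. 0 < e \<Longrightarrow> \<exists>K. \<forall>F\<in>L. \<forall>A\<in>sets M. (LINT s:A|M. norm (ae_rep F s)) \<le> e + K * measure M A"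
    and closed: "closedin (weak_topology (L1_space M)) L"
  shows "compactin (weak_topology (L1_space M)) L"
proof -
  \<comment> \<open>Positive parts appear because \<open>density_of_additive\<close> treats
    nonnegative set functions. Indexing by all pairs gives an ordinary function type with its
    product topology, so non-measurable \<open>A\<close> need a value too, here 0.\<close>
  define T :: "('a \<Rightarrow> 'e) set \<Rightarrow> 'a set \<times> 'e \<Rightarrow> real" where
    "T F = (\<lambda>(A, u). if A \<in> sets M then (LINT s:A|M. max 0 (ae_rep F s \<bullet> u)) else 0)" for F
  define P where "P = closure (T ` L)"
  have int: "integrable M (\<lambda>s. max 0 (ae_rep F s \<bullet> u))" if "F \<in> L" for F u
    using L1_space_carrierE(1)[of F M] sub that by (intro integrable_max) auto
  have intA: "integrable M (\<lambda>s. indicat_real A s * max 0 (ae_rep F s \<bullet> u))"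
    if "F \<in> L" "A \<in> sets M" for F u A
    using integrable_mult_indicator[OF that(2) int[OF that(1), of u]] by simp
  have T_nonneg: "0 \<le> T F (A, u)" for F A u
    by (auto simp: T_def set_lebesgue_integral_def intro!: integral_nonneg_AE)
  have T_le: "T F (A, u) \<le> norm u * (LINT s:A|M. norm (ae_rep F s))"
    if "F \<in> L" "A \<in> sets M" for F A u
  proof -
    have i: "integrable M (ae_rep F)" using L1_space_carrierE(1)[of F M] sub that by auto
    have "(LINT s|M. indicat_real A s * max 0 (ae_rep F s \<bullet> u)) \<le>
        (LINT s|M. norm u * (indicat_real A s * norm (ae_rep F s)))"
    proof (rule integral_mono[OF intA[OF that]])
      show "integrable M (\<lambda>s. norm u * (indicat_real A s * norm (ae_rep F s)))"
        using integrable_mult_indicator[OF that(2) integrable_norm[OF i]] by simp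
      show "indicat_real A s * max 0 (ae_rep F s \<bullet> u) \<le> norm u * (indicat_real A s * norm (ae_rep F s))" for s
        using Cauchy_Schwarz_ineq2[of "ae_rep F s" u]
        by (auto simp: mult.commute split: split_indicator)
    qed
    then show ?thesis using that by (simp add: T_def set_lebesgue_integral_def)
  qed
  have T_ac: "\<exists>K. \<forall>p\<in>T ` L. \<forall>A\<in>sets M. p (A, u) \<le> e + K * measure M A" if "0 < e" for e u
  proof -
    have u: "0 < norm u + 1" by (rule add_nonneg_pos) auto
    with that obtain K where
      K: "\<forall>F\<in>L. \<forall>A\<in>sets M. (LINT s:A|M. norm (ae_rep F s)) \<le> e / (norm u + 1) + K * measure M A"
      using ui[of "e / (norm u + 1)"] by auto
    have "T F (A, u) \<le> e + ((norm u + 1) * K) * measure M A" if F: "F \<in> L" and A: "A \<in> sets M" for F A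
    proof -
      have "T F (A, u) \<le> (norm u + 1) * (LINT s:A|M. norm (ae_rep F s))"
        by (rule order_trans[OF T_le[OF F A] mult_right_mono])
          (auto simp: set_lebesgue_integral_def intro!: integral_nonneg_AE)
      also have "\<dots> \<le> (norm u + 1) * (e / (norm u + 1) + K * measure M A)"
        using K F A u by (intro mult_left_mono) auto
      also have "\<dots> = e + ((norm u + 1) * K) * measure M A"
        using u by (simp add: distrib_left mult.assoc)
      finally show ?thesis .
    qed
    then show ?thesis by blast
  qed
  have coord: "continuous_on S (\<lambda>p::'a set \<times> 'e \<Rightarrow> real. p i)" for S i
    by (rule continuous_on_subset[OF continuous_on_product_coordinates]) simp
  have P_nonneg: "0 \<le> p i" if "p \<in> P" for p i
  proof -
    have "closure (T ` L) \<subseteq> {p. 0 \<le> p i}"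
      using T_nonneg by (intro closure_minimal closed_Collect_le coord continuous_on_const) (auto, cases i, auto)
    then show ?thesis using that by (auto simp: P_def)
  qed
  have P_ac: "\<exists>K. \<forall>p\<in>P. \<forall>A\<in>sets M. p (A, u) \<le> e + K * measure M A" if e: "0 < e" for e u
  proof -
    obtain K where K: "\<forall>p\<in>T ` L. \<forall>A\<in>sets M. p (A, u) \<le> e + K * measure M A"
      using T_ac[OF e] by blast
    have "p (A, u) \<le> e + K * measure M A" if "p \<in> P" "A \<in> sets M" for p A
    proof -
      have "closure (T ` L) \<subseteq> {p. p (A, u) \<le> e + K * measure M A}"
        using K that by (intro closure_minimal closed_Collect_le coord continuous_on_const) auto
      then show ?thesis using that by (auto simp: P_def)
    qed
    then show ?thesis by blast
  qed
  have P_add: "p (A \<union> B, u) = p (A, u) + p (B, u)"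
    if "p \<in> P" "A \<in> sets M" "B \<in> sets M" "A \<inter> B = {}" for p A B u
  proof -
    have "T F (A \<union> B, u) = T F (A, u) + T F (B, u)" if F: "F \<in> L" for F
    proof -
      have "indicat_real (A \<union> B) s = indicat_real A s + indicat_real B s" for s
        using \<open>A \<inter> B = {}\<close> by (auto split: split_indicator)
      then show ?thesis
        using intA[OF F \<open>A \<in> sets M\<close>, of u] intA[OF F \<open>B \<in> sets M\<close>, of u] that \<open>A \<in> sets M\<close> \<open>B \<in> sets M\<close>
        by (simp add: T_def set_lebesgue_integral_def distrib_right)
    qed
    then have "closure (T ` L) \<subseteq> {p. p (A \<union> B, u) = p (A, u) + p (B, u)}"
      by (intro closure_minimal closed_Collect_eq coord continuous_on_add) auto
    then show ?thesis using that by (auto simp: P_def)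
  qed
  \<comment> \<open>Uniform integrability at level 1, with the total mass as bound for the measure,
    confines each coordinate to an interval; Tychonoff then applies to the product of these
    intervals.\<close>
  have "\<exists>b. \<forall>p\<in>P. \<forall>A. p (A, u) \<le> b" for u
  proof -
    obtain K where K: "\<forall>p\<in>T ` L. \<forall>A\<in>sets M. p (A, u) \<le> 1 + K * measure M A"
      using T_ac[of 1 u] by auto
    have "T F (A, u) \<le> 1 + \<bar>K\<bar> * measure M (space M)" if "F \<in> L" for F A
    proof (cases "A \<in> sets M")
      case True
      then have "T F (A, u) \<le> 1 + K * measure M A" using K that by blast
      also have "K * measure M A \<le> \<bar>K\<bar> * measure M (space M)"
        by (intro mult_mono bounded_measure) auto
      finally show ?thesis by simp
    qed (simp add: T_def)
    then have "closure (T ` L) \<subseteq> {p. p (A, u) \<le> 1 + \<bar>K\<bar> * measure M (space M)}" for A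
      by (intro closure_minimal closed_Collect_le coord continuous_on_const) auto
    then show ?thesis unfolding P_def by blast
  qed
  then obtain b where b: "\<And>u p A. p \<in> P \<Longrightarrow> p (A, u) \<le> b u" by metis
  have "compact (PiE UNIV (\<lambda>(A, u). {0..b u}) :: ('a set \<times> 'e \<Rightarrow> real) set)"
  proof -
    have "compactin (product_topology (\<lambda>i::'a set \<times> 'e. euclideanreal) UNIV)
        (PiE UNIV (\<lambda>(A, u). {0..b u}))"
      unfolding compactin_PiE by auto
    then show ?thesis by (simp add: euclidean_product_topology)
  qed
  moreover have "P \<subseteq> PiE UNIV (\<lambda>(A, u). {0..b u})"
    using b P_nonneg by (auto simp: PiE_iff)
  ultimately have compact: "compact P"
    unfolding P_def by (metis closed_closure closed_subset compact_Int_closed inf.absorb_iff2 closed_Int_compact)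
  have "\<exists>h. integrable M h \<and> (\<forall>s. 0 \<le> h s) \<and> (\<forall>A\<in>sets M. (LINT s:A|M. h s) = p (A, u))"
    if "p \<in> P" for p u
  proof -
    have "\<exists>K. \<forall>A\<in>sets M. p (A, u) \<le> e + K * measure M A" if "0 < e" for e
      using P_ac[OF that] \<open>p \<in> P\<close> by blast
    then show ?thesis
      using P_nonneg[OF that] P_add[OF that]
      by (rule_tac density_of_additive[of "\<lambda>A. p (A, u)"]) auto
  qed
  then obtain h where h: "\<And>p u. p \<in> P \<Longrightarrow> integrable M (h p u)" "\<And>p u s. p \<in> P \<Longrightarrow> 0 \<le> h p u s"
    "\<And>p u A. p \<in> P \<Longrightarrow> A \<in> sets M \<Longrightarrow> (LINT s:A|M. h p u s) = p (A, u)"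
    by metis
  have h_cont: "continuous_on P (\<lambda>p. LINT s|M. h p u s * g s)"
    if "g \<in> borel_measurable M" "\<And>s. \<bar>g s\<bar> \<le> C" for u g C
  proof (rule continuous_on_integral_mult_bounded[where B = "b u"])
    fix p assume p: "p \<in> P"
    have "(LINT s|M. h p u s) = (LINT s:space M|M. h p u s)"
      unfolding set_lebesgue_integral_def by (intro Bochner_Integration.integral_cong) auto
    also have "\<dots> = p (space M, u)" using p by (intro h) auto
    also have "\<dots> \<le> b u" by (rule b[OF p])
    finally show "(LINT s|M. h p u s) \<le> b u" .
  next
    fix A assume "A \<in> sets M"
    then show "continuous_on P (\<lambda>p. LINT s:A|M. h p u s)"
      using coord[of P "(A, u)"] h(3) by (simp cong: continuous_on_cong)
  qed (use h that in auto)
  \<comment> \<open>\<open>h p i\<close> and \<open>h p (- i)\<close> play the roles of the positive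
    and negative part of the coordinate along \<open>i\<close>.\<close>
  define f where "f p s = (\<Sum>i\<in>Basis. (h p i s - h p (- i) s) *\<^sub>R i)" for p s
  have f_int: "integrable M (f p)" if "p \<in> P" for p
    unfolding f_def using h(1)[OF that] by (intro Bochner_Integration.integrable_sum) auto
  define G where "G p = ae_class M (f p)" for p
  have G_carrier: "G p \<in> vcarrier (L1_space M)" if "p \<in> P" for p
    using f_int[OF that] by (simp add: G_def ae_class_in_L1_space)
  have "continuous_map (top_of_set P) (weak_topology (L1_space M)) G"
  proof (rule continuous_map_into_weak_topology)
    fix \<Lambda> :: "('a \<Rightarrow> 'e) set \<Rightarrow> real" assume "\<Lambda> \<in> dual_functionals (L1_space M)"
    from L1_dual_representation[OF this] obtain g C where
      g: "g \<in> borel_measurable M" "\<And>s. norm (g s) \<le> C" and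
      rep: "\<And>f. integrable M f \<Longrightarrow> \<Lambda> (ae_class M f) = (LINT s|M. f s \<bullet> g s)" by blast
    have gm: "(\<lambda>s. i \<bullet> g s) \<in> borel_measurable M" for i using g(1) by measurable
    have gC: "\<bar>i \<bullet> g s\<bar> \<le> C" if "i \<in> Basis" for i s
      using Basis_le_norm[OF that, of "g s"] g(2)[of s] by (simp add: inner_commute)
    have hg: "integrable M (\<lambda>s. h p u s * (i \<bullet> g s))" if "p \<in> P" "i \<in> Basis" for p u i
      using integrable_inner_bounded[OF h(1)[OF that(1)] gm, of i C] gC[OF that(2)] by simp
    have "\<Lambda> (G p) = (\<Sum>i\<in>Basis. (LINT s|M. h p i s * (i \<bullet> g s)) - (LINT s|M. h p (- i) s * (i \<bullet> g s)))"
      if "p \<in> P" for p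
    proof -
      have "\<Lambda> (G p) = (LINT s|M. (\<Sum>i\<in>Basis. h p i s * (i \<bullet> g s) - h p (- i) s * (i \<bullet> g s)))"
        unfolding G_def rep[OF f_int[OF that]]
        by (simp add: f_def inner_sum_left left_diff_distrib)
      also have "\<dots> = (\<Sum>i\<in>Basis. LINT s|M. h p i s * (i \<bullet> g s) - h p (- i) s * (i \<bullet> g s))"
        using hg[OF that] by (intro Bochner_Integration.integral_sum) auto
      finally show ?thesis using hg[OF that] by simp
    qed
    moreover have "continuous_on P (\<lambda>p. \<Sum>i\<in>Basis.
        (LINT s|M. h p i s * (i \<bullet> g s)) - (LINT s|M. h p (- i) s * (i \<bullet> g s)))"
      by (intro continuous_intros h_cont[OF gm gC])
    ultimately show "continuous_map (top_of_set P) euclideanreal (\<lambda>p. \<Lambda> (G p))"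
      by (simp cong: continuous_on_cong)
  qed (use G_carrier in auto)
  then have "compactin (weak_topology (L1_space M)) (G ` P)"
    using compact by (intro image_compactin[of "top_of_set P"]) (auto simp: compactin_subtopology)
  \<comment> \<open>At \<open>p = T F\<close> the densities have the same set integrals as the
    positive parts of \<open>F\<close>, hence agree with them almost everywhere and \<open>G\<close>
    returns \<open>F\<close>. So \<open>L\<close> is a closed subset of a compact set.\<close>
  moreover have "L \<subseteq> G ` P"
  proof
    fix F assume F: "F \<in> L"
    then have p: "T F \<in> P" unfolding P_def by (intro subsetD[OF closure_subset] imageI)
    have hT: "AE s in M. h (T F) u s = max 0 (ae_rep F s \<bullet> u)" for u
      using h(1)[OF p, of u] int[OF F, of u] h(3)[OF p]
      by (intro density_unique_real) (auto simp: T_def)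
    then have "AE s in M. \<forall>i\<in>Basis. h (T F) i s = max 0 (ae_rep F s \<bullet> i) \<and>
        h (T F) (- i) s = max 0 (ae_rep F s \<bullet> - i)"
      by (intro AE_finite_allI AE_conjI finite_Basis hT)
    then have "AE s in M. f (T F) s = ae_rep F s"
    proof eventually_elim
      case (elim s)
      then have "f (T F) s = (\<Sum>i\<in>Basis. (ae_rep F s \<bullet> i) *\<^sub>R i)"
        unfolding f_def by (intro sum.cong) auto
      then show ?case by (simp add: euclidean_representation)
    qed
    then have "G (T F) = ae_class M (ae_rep F)"
      unfolding G_def by (rule ae_class_eqI)
    then have "G (T F) = F" using L1_space_carrierE(2)[of F M] F sub by auto
    with p show "F \<in> G ` P" by force
  qed
  ultimately show ?thesis using closed by (rule closed_compactin)
qed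

section \<open>Integral functionals\<close>

text \<open>Pointwise, \<open>h + m\<close> plus the negative part of \<open>h\<close> equals the
  positive part of \<open>h\<close> plus \<open>m\<close>; the negative part has finite integral
  because it is at most \<open>m\<close> on a finite measure space. The integral thereby becomes a
  single nonnegative one, to which monotone convergence applies.\<close>

lemma ereal_integral_shift:
  assumes [measurable]: "h \<in> borel_measurable M" and m: "0 \<le> m" and low: "\<And>s. ereal (- m) \<le> h s"
  shows "ereal_integral M h =
    enn2ereal (\<integral>\<^sup>+s. e2ennreal (h s + ereal m) \<partial>M) - ereal (m * measure M (space M))"
proof -
  let ?P = "\<integral>\<^sup>+s. e2ennreal (h s) \<partial>M" and ?N = "\<integral>\<^sup>+s. e2ennreal (- h s) \<partial>M"
    and ?T = "\<integral>\<^sup>+s. e2ennreal (h s + ereal m) \<partial>M"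
  have "e2ennreal (- h s) \<le> ennreal m" for s
    using low[of s] by (cases "h s") (auto simp: e2ennreal_neg ennreal_leI)
  then have "?N \<le> (\<integral>\<^sup>+s. ennreal m \<partial>M)" by (intro nn_integral_mono)
  also have "\<dots> = ennreal (m * measure M (space M))"
    using m by (simp add: emeasure_eq_measure ennreal_mult)
  finally have "?N \<le> ennreal (m * measure M (space M))" .
  then obtain b where b: "?N = ennreal b" "0 \<le> b"
    by (cases ?N) (auto simp: top_unique)
  have "?T + ?N = (\<integral>\<^sup>+s. e2ennreal (h s + ereal m) + e2ennreal (- h s) \<partial>M)"
    by (rule nn_integral_add[symmetric]) measurable
  also have "\<dots> = (\<integral>\<^sup>+s. e2ennreal (h s) + ennreal m \<partial>M)"
  proof (rule nn_integral_cong)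
    fix s
    show "e2ennreal (h s + ereal m) + e2ennreal (- h s) = e2ennreal (h s) + ennreal m"
    proof (cases "h s")
      case (real r)
      then have "- m \<le> r" using low[of s] by simp
      then show ?thesis using real m
        by (cases "0 \<le> r") (simp_all add: ennreal_neg ennreal_plus[symmetric] del: ennreal_plus)
    qed (use low[of s] in auto)
  qed
  also have "\<dots> = ?P + (\<integral>\<^sup>+s. ennreal m \<partial>M)" by (rule nn_integral_add) measurable
  also have "(\<integral>\<^sup>+s. ennreal m \<partial>M) = ennreal (m * measure M (space M))"
    using m by (simp add: emeasure_eq_measure ennreal_mult)
  finally have eq: "?T + ?N = ?P + ennreal (m * measure M (space M))" .
  have "0 \<le> m * measure M (space M)" using m by simp
  with eq b show ?thesis
    unfolding ereal_integral_def
    by (cases ?T; cases ?P) (auto simp: ennreal_plus[symmetric] simp del: ennreal_plus)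
qed

lemma ereal_integral_lessD:
  assumes [measurable]: "h \<in> borel_measurable M" and m: "0 \<le> m" and low: "\<And>s. ereal (- m) \<le> h s"
    and less: "ereal_integral M h < \<infinity>"
  shows "AE s in M. h s = ereal (real_of_ereal (h s))" "integrable M (\<lambda>s. real_of_ereal (h s))"
proof -
  have "enn2ereal (\<integral>\<^sup>+s. e2ennreal (h s + ereal m) \<partial>M) - ereal (m * measure M (space M)) < \<infinity>"
    using less unfolding ereal_integral_shift[OF assms(1-3)] .
  then have fin: "(\<integral>\<^sup>+s. e2ennreal (h s + ereal m) \<partial>M) \<noteq> \<infinity>"
    by (cases "\<integral>\<^sup>+s. e2ennreal (h s + ereal m) \<partial>M") auto
  then have "AE s in M. e2ennreal (h s + ereal m) \<noteq> \<infinity>"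
    by (intro nn_integral_noteq_infinite) measurable
  then show ae: "AE s in M. h s = ereal (real_of_ereal (h s))"
  proof eventually_elim
    case (elim s)
    then show ?case using low[of s] by (cases "h s") auto
  qed
  have "integrable M (\<lambda>s. real_of_ereal (h s) + m)"
  proof (rule integrableI_nonneg)
    have "0 \<le> real_of_ereal (h s) + m" for s
      using low[of s] m by (cases "h s") auto
    then show "AE s in M. 0 \<le> real_of_ereal (h s) + m" by simp
    have "(\<integral>\<^sup>+s. ennreal (real_of_ereal (h s) + m) \<partial>M) = (\<integral>\<^sup>+s. e2ennreal (h s + ereal m) \<partial>M)"
      using ae
    proof (intro nn_integral_cong_AE, eventually_elim)
      case (elim s)
      then show ?case by (cases "h s") auto
    qed
    with fin show "(\<integral>\<^sup>+s. ennreal (real_of_ereal (h s) + m) \<partial>M) < \<infinity>"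
      by (simp add: less_top)
  qed measurable
  then have "integrable M (\<lambda>s. (real_of_ereal (h s) + m) - m)"
    by (rule Bochner_Integration.integrable_diff) simp
  then show "integrable M (\<lambda>s. real_of_ereal (h s))" by simp
qed

lemma ereal_integral_eq:
  assumes [measurable]: "h \<in> borel_measurable M" and m: "0 \<le> m" and low: "\<And>s. ereal (- m) \<le> h s"
    and ae: "AE s in M. h s = ereal (real_of_ereal (h s))" and int: "integrable M (\<lambda>s. real_of_ereal (h s))"
  shows "ereal_integral M h = ereal (LINT s|M. real_of_ereal (h s))"
proof -
  have nn: "0 \<le> real_of_ereal (h s) + m" for s
    using low[of s] m by (cases "h s") auto
  have "(\<integral>\<^sup>+s. e2ennreal (h s + ereal m) \<partial>M) = (\<integral>\<^sup>+s. ennreal (real_of_ereal (h s) + m) \<partial>M)"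
    using ae
  proof (intro nn_integral_cong_AE, eventually_elim)
    case (elim s)
    then show ?case by (cases "h s") auto
  qed
  also have "\<dots> = ennreal (LINT s|M. real_of_ereal (h s) + m)"
    using int nn by (intro nn_integral_eq_integral) auto
  finally have "enn2ereal (\<integral>\<^sup>+s. e2ennreal (h s + ereal m) \<partial>M) = ereal (LINT s|M. real_of_ereal (h s) + m)"
    using nn by (simp add: integral_nonneg_AE)
  then show ?thesis
    unfolding ereal_integral_shift[OF assms(1-3)] using int by (simp add: mult.commute)
qed

end

section \<open>Measurable monotone approximation from below\<close>

context strictly_convex_conjugate
begin

text \<open>\<open>Y n x\<close> is the best slope at \<open>x\<close> among 0 and the first
  \<open>n\<close> terms of a dense sequence. It takes finitely many values, hence is measurable and
  bounded, so \<open>Y n\<close> composed with any measurable \<open>f\<close> is a legitimate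
  bounded test function; starting from slope 0 gives the uniform lower bound.\<close>

lemma affine_approximation:
  obtains Y where "\<And>n. Y n \<in> borel_measurable borel" "\<And>n. \<exists>C. \<forall>x. norm (Y n x) \<le> C"
    "\<And>x. incseq (\<lambda>n. x \<bullet> Y n x - \<psi> (Y n x))" "\<And>n x. - \<bar>\<psi> 0\<bar> \<le> x \<bullet> Y n x - \<psi> (Y n x)"
    "\<And>x c. ereal c < \<phi> x \<Longrightarrow> \<exists>n. c < x \<bullet> Y n x - \<psi> (Y n x)"
proof -
  obtain D :: "'e set" where D: "countable D" "\<And>U. open U \<Longrightarrow> U \<noteq> {} \<Longrightarrow> \<exists>d\<in>D. d \<in> U"
    by (rule countable_dense_setE) (rule that)
  have "D \<noteq> {}" using D(2)[of UNIV] by auto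
  then obtain d :: "nat \<Rightarrow> 'e" where d: "range d = D"
    using range_from_nat_into[OF _ D(1)] by blast
  have [measurable]: "\<psi> \<in> borel_measurable borel"
    by (rule borel_measurable_continuous_onI[OF cont])
  define Y where "Y = rec_nat (\<lambda>_. 0) (\<lambda>n y x.
    if x \<bullet> y x - \<psi> (y x) < x \<bullet> d n - \<psi> (d n) then d n else y x)"
  have Y: "Y 0 x = 0" "Y (Suc n) x = (if x \<bullet> Y n x - \<psi> (Y n x) < x \<bullet> d n - \<psi> (d n) then d n else Y n x)" for n x
    by (simp_all add: Y_def)
  have Y_abs: "Y 0 = (\<lambda>x. 0)" "Y (Suc n) = (\<lambda>x. if x \<bullet> Y n x - \<psi> (Y n x) < x \<bullet> d n - \<psi> (d n) then d n else Y n x)" for n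
    by (simp_all add: Y fun_eq_iff)
  show thesis
  proof (rule that[of Y])
    show "Y n \<in> borel_measurable borel" for n
    proof (induction n)
      case (Suc n)
      note [measurable] = Suc
      show ?case unfolding Y_abs by measurable
    qed (simp add: Y_abs)
    show "\<exists>C. \<forall>x. norm (Y n x) \<le> C" for n
    proof (induction n)
      case (Suc n)
      then obtain C where "\<forall>x. norm (Y n x) \<le> C" by blast
      then have "\<forall>x. norm (Y (Suc n) x) \<le> max C (norm (d n))" by (auto simp: Y le_max_iff_disj)
      then show ?case by blast
    qed (auto simp: Y)
    show inc: "incseq (\<lambda>n. x \<bullet> Y n x - \<psi> (Y n x))" for x
      by (intro incseq_SucI) (simp add: Y)
    show "- \<bar>\<psi> 0\<bar> \<le> x \<bullet> Y n x - \<psi> (Y n x)" for n x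
      using incseqD[OF inc[of x], of 0 n] by (simp add: Y)
    fix x c assume "ereal c < \<phi> x"
    then obtain y where "y \<in> D" "c < x \<bullet> y - \<psi> y"
      using D(2) by (rule fenchel_moreau_dense)
    then obtain n where n: "c < x \<bullet> d n - \<psi> (d n)" using d by blast
    then have "c < x \<bullet> Y (Suc n) x - \<psi> (Y (Suc n) x)" by (simp add: Y)
    then show "\<exists>n. c < x \<bullet> Y n x - \<psi> (Y n x)" by blast
  qed
qed

end

section \<open>Duality formula, level sets, properness and strict convexity of the integral
  functional\<close>

locale convex_integral_functional = finite_measure M + strictly_convex_conjugate \<phi> \<psi>
  for M :: "'s measure" and \<phi> :: "'e::euclidean_space \<Rightarrow> ereal" and \<psi>
begin

lemma phi_measurable [measurable]: "\<phi> \<in> borel_measurable borel"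
  by (rule lower_semicontinuous_borel_measurable[OF lsc])

lemma psi_measurable [measurable]: "\<psi> \<in> borel_measurable borel"
  by (rule borel_measurable_continuous_onI[OF cont])

lemma integral_lessD:
  assumes [measurable]: "f \<in> borel_measurable M" and "ereal_integral M (\<lambda>s. \<phi> (f s)) < \<infinity>"
  shows "AE s in M. \<phi> (f s) = ereal (real_of_ereal (\<phi> (f s)))"
    "integrable M (\<lambda>s. real_of_ereal (\<phi> (f s)))"
    "ereal_integral M (\<lambda>s. \<phi> (f s)) = ereal (LINT s|M. real_of_ereal (\<phi> (f s)))"
proof -
  have "(\<lambda>s. \<phi> (f s)) \<in> borel_measurable M" by measurable
  note D = ereal_integral_lessD[OF this _ lower_bound assms(2)] ereal_integral_eq[OF this _ lower_bound]
  show "AE s in M. \<phi> (f s) = ereal (real_of_ereal (\<phi> (f s)))"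
    "integrable M (\<lambda>s. real_of_ereal (\<phi> (f s)))" by (rule D; simp)+
  then show "ereal_integral M (\<lambda>s. \<phi> (f s)) = ereal (LINT s|M. real_of_ereal (\<phi> (f s)))"
    by (intro D(3)) auto
qed

lemma integral_eqI:
  assumes [measurable]: "f \<in> borel_measurable M"
    and "AE s in M. \<phi> (f s) = ereal (real_of_ereal (\<phi> (f s)))" "integrable M (\<lambda>s. real_of_ereal (\<phi> (f s)))"
  shows "ereal_integral M (\<lambda>s. \<phi> (f s)) = ereal (LINT s|M. real_of_ereal (\<phi> (f s)))"
  using assms(2,3) by (intro ereal_integral_eq[OF _ _ lower_bound]) auto

lemma integrable_psi:
  assumes [measurable]: "g \<in> borel_measurable M" and C: "\<And>s. norm (g s) \<le> C"
  shows "integrable M (\<lambda>s. \<psi> (g s))"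
proof -
  have "bounded (\<psi> ` cball 0 C)"
    by (intro compact_imp_bounded compact_continuous_image continuous_on_subset[OF cont]) auto
  then obtain B where "\<forall>y\<in>cball 0 C. \<bar>\<psi> y\<bar> \<le> B" by (auto simp: bounded_iff)
  then have "\<bar>\<psi> (g s)\<bar> \<le> B" for s using C[of s] by auto
  then show ?thesis by (intro integrable_const_bound[of _ B]) auto
qed

lemma integrable_affine:
  assumes "integrable M f" "g \<in> borel_measurable M" and C: "\<And>s. norm (g s) \<le> C"
  shows "integrable M (\<lambda>s. f s \<bullet> g s - \<psi> (g s))"
  using integrable_inner_bounded[OF assms] integrable_psi[OF assms(2,3)] by simp

text \<open>Integrated Young inequality: one half of the formula expressing the functional as the
  supremum over bounded \<open>g\<close> of the integrals of
  \<open>f s \<bullet> g s - \<psi> (g s)\<close>. The other half is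
  \<open>integral_leI\<close>.\<close>

lemma affine_integral_le:
  assumes f: "integrable M f" and g: "g \<in> borel_measurable M" "\<And>s. norm (g s) \<le> C"
    and le: "ereal_integral M (\<lambda>s. \<phi> (f s)) \<le> ereal r"
  shows "(LINT s|M. f s \<bullet> g s - \<psi> (g s)) \<le> r"
proof -
  have "ereal_integral M (\<lambda>s. \<phi> (f s)) < \<infinity>" using le by auto
  note D = integral_lessD[OF _ this]
  have "AE s in M. f s \<bullet> g s - \<psi> (g s) \<le> real_of_ereal (\<phi> (f s))"
    using D(1)[OF borel_measurable_integrable[OF f]]
  proof eventually_elim
    case (elim s)
    then show ?case using young[of "f s" "g s"] by (metis ereal_less_eq(3))
  qed
  then have "(LINT s|M. f s \<bullet> g s - \<psi> (g s)) \<le> (LINT s|M. real_of_ereal (\<phi> (f s)))"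
    using f by (intro integral_mono_AE integrable_affine[OF f g] D) auto
  then show ?thesis using D(3) f le by auto
qed

text \<open>The test functions \<open>\<lambda>s. Y n (f s)\<close> are admissible and their
  integrands increase to \<open>\<phi> (f s)\<close>; monotone convergence applies after the shift
  by \<open>m\<close>.\<close>

lemma integral_leI:
  assumes f: "integrable M f"
    and le: "\<And>g C. g \<in> borel_measurable M \<Longrightarrow> (\<And>s. norm (g s) \<le> C) \<Longrightarrow>
      (LINT s|M. f s \<bullet> g s - \<psi> (g s)) \<le> r"
  shows "ereal_integral M (\<lambda>s. \<phi> (f s)) \<le> ereal r"
proof -
  note [measurable] = borel_measurable_integrable[OF f]
  define m where "m = \<bar>\<psi> 0\<bar>"
  obtain Y where Y [measurable]: "\<And>n. Y n \<in> borel_measurable borel"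
    and YC: "\<And>n. \<exists>C. \<forall>x. norm (Y n x) \<le> C"
    and inc: "\<And>x. incseq (\<lambda>n. x \<bullet> Y n x - \<psi> (Y n x))" and low: "\<And>n x. - m \<le> x \<bullet> Y n x - \<psi> (Y n x)"
    and sup: "\<And>x c. ereal c < \<phi> x \<Longrightarrow> \<exists>n. c < x \<bullet> Y n x - \<psi> (Y n x)"
    unfolding m_def using affine_approximation by blast
  define v where "v n x = x \<bullet> Y n x - \<psi> (Y n x)" for n x
  have [measurable]: "v n \<in> borel_measurable borel" for n unfolding v_def by measurable
  have v: "incseq (\<lambda>n. v n x)" "- m \<le> v n x" "ereal (v n x) \<le> \<phi> x" for n x
    using inc low young by (auto simp: v_def)
  \<comment> \<open>Testing with reals below \<open>\<phi> x\<close> covers the value infinity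
    without a separate case.\<close>
  have le_SUP: "e2ennreal (\<phi> x + ereal m) \<le> (SUP n. ennreal (v n x + m))" for x
  proof (rule dense_le)
    fix z assume z: "z < e2ennreal (\<phi> x + ereal m)"
    then obtain c where c: "z = ennreal c" "0 \<le> c" by (cases z) auto
    have "ereal (c - m) < \<phi> x"
      using z c by (cases "\<phi> x") (auto simp: ennreal_less_iff e2ennreal_neg)
    then obtain n where "c - m < v n x" using sup unfolding v_def by blast
    then have "z \<le> ennreal (v n x + m)" using c by (auto intro: ennreal_leI)
    also have "\<dots> \<le> (SUP n. ennreal (v n x + m))" by (rule SUP_upper) simp
    finally show "z \<le> (SUP n. ennreal (v n x + m))" .
  qed
  have "(\<integral>\<^sup>+s. e2ennreal (\<phi> (f s) + ereal m) \<partial>M) \<le> (\<integral>\<^sup>+s. (SUP n. ennreal (v n (f s) + m)) \<partial>M)"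
    by (intro nn_integral_mono le_SUP)
  also have "\<dots> = (SUP n. \<integral>\<^sup>+s. ennreal (v n (f s) + m) \<partial>M)"
    using v(1) by (intro nn_integral_monotone_convergence_SUP) (auto simp: incseq_def le_fun_def intro!: ennreal_leI)
  also have "\<dots> \<le> ennreal (r + m * measure M (space M))"
  proof (rule SUP_least)
    fix n
    obtain C where C: "\<And>x. norm (Y n x) \<le> C" using YC by blast
    have i: "integrable M (\<lambda>s. v n (f s))"
      unfolding v_def by (rule integrable_affine[OF f _ C]) measurable
    have "(LINT s|M. v n (f s)) \<le> r" unfolding v_def by (rule le[OF _ C]) measurable
    then have "(LINT s|M. v n (f s) + m) \<le> r + m * measure M (space M)"
      using i by (simp add: mult.commute)
    moreover have "0 \<le> v n x + m" for x using v(2)[of n x] by simp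
    then have "(\<integral>\<^sup>+s. ennreal (v n (f s) + m) \<partial>M) = ennreal (LINT s|M. v n (f s) + m)"
      using i by (intro nn_integral_eq_integral) auto
    ultimately show "(\<integral>\<^sup>+s. ennreal (v n (f s) + m) \<partial>M) \<le> ennreal (r + m * measure M (space M))"
      by (simp add: ennreal_leI)
  qed
  finally have "(\<integral>\<^sup>+s. e2ennreal (\<phi> (f s) + ereal m) \<partial>M) \<le> ennreal (r + m * measure M (space M))" .
  \<comment> \<open>\<open>ennreal\<close> sends negative numbers to 0, so the return to
    \<open>ereal\<close> needs a nonnegative bound; the test function 0 provides it.\<close>
  moreover have "0 \<le> r + m * measure M (space M)"
  proof -
    have "(LINT s|M. f s \<bullet> 0 - \<psi> 0) \<le> r" by (rule le[of _ 0]) auto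
    then have "- \<psi> 0 * measure M (space M) \<le> r" by (simp add: mult.commute)
    moreover have "- m * measure M (space M) \<le> - \<psi> 0 * measure M (space M)"
      by (intro mult_right_mono) (auto simp: m_def)
    ultimately show ?thesis by simp
  qed
  ultimately have "enn2ereal (\<integral>\<^sup>+s. e2ennreal (\<phi> (f s) + ereal m) \<partial>M) \<le> ereal (r + m * measure M (space M))"
    by (metis enn2ereal_ennreal less_eq_ennreal.rep_eq)
  moreover have "ereal_integral M (\<lambda>s. \<phi> (f s)) =
    enn2ereal (\<integral>\<^sup>+s. e2ennreal (\<phi> (f s) + ereal m) \<partial>M) - ereal (m * measure M (space M))"
    using lower_bound by (intro ereal_integral_shift) (auto simp: m_def)
  ultimately show ?thesis
    by (cases "enn2ereal (\<integral>\<^sup>+s. e2ennreal (\<phi> (f s) + ereal m) \<partial>M)") auto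
qed

lemma closedin_level_set:
  "closedin (weak_topology (L1_space M)) {F \<in> vcarrier (L1_space M). integral_functional M \<phi> F \<le> ereal r}"
proof -
  define S where "S = {g. g \<in> borel_measurable M \<and> (\<exists>C. \<forall>s. norm (g s :: 'e) \<le> C)}"
  have "{F \<in> vcarrier (L1_space M). integral_functional M \<phi> F \<le> ereal r} =
    (\<Inter>g\<in>S. {F \<in> topspace (weak_topology (L1_space M)). pairing M g F \<in> {..r + (LINT s|M. \<psi> (g s))}})"
    (is "?L = ?R")
  proof (intro set_eqI iffI)
    fix F assume F: "F \<in> ?L"
    then have f: "integrable M (ae_rep F)" using L1_space_carrierE(1) by blast
    have "pairing M g F \<le> r + (LINT s|M. \<psi> (g s))" if g: "g \<in> S" for g
    proof -
      obtain C where gC: "g \<in> borel_measurable M" "\<And>s. norm (g s) \<le> C" using g by (auto simp: S_def)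
      have "(LINT s|M. ae_rep F s \<bullet> g s - \<psi> (g s)) \<le> r"
        using F by (intro affine_integral_le[OF f gC]) (auto simp: integral_functional_def)
      then show ?thesis
        using integrable_inner_bounded[OF f gC] integrable_psi[OF gC] by (simp add: pairing_def)
    qed
    with F show "F \<in> ?R" by (auto simp: topspace_weak_topology)
  next
    fix F assume F: "F \<in> ?R"
    moreover have "(\<lambda>_. 0) \<in> S" by (auto simp: S_def)
    ultimately have car: "F \<in> vcarrier (L1_space M)" by (auto simp: topspace_weak_topology)
    then have f: "integrable M (ae_rep F)" using L1_space_carrierE(1) by blast
    have "ereal_integral M (\<lambda>s. \<phi> (ae_rep F s)) \<le> ereal r"
    proof (rule integral_leI[OF f])
      fix g :: "'s \<Rightarrow> 'e" and C assume gC: "g \<in> borel_measurable M" "\<And>s. norm (g s) \<le> C"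
      then have "pairing M g F \<le> r + (LINT s|M. \<psi> (g s))" using F by (auto simp: S_def)
      then show "(LINT s|M. ae_rep F s \<bullet> g s - \<psi> (g s)) \<le> r"
        using integrable_inner_bounded[OF f gC] integrable_psi[OF gC] by (simp add: pairing_def)
    qed
    with car show "F \<in> ?L" by (simp add: integral_functional_def)
  qed
  moreover have "closedin (weak_topology (L1_space M)) ?R"
  proof (rule closedin_INT)
    show "S \<noteq> {}" by (auto simp: S_def intro!: exI[of _ "\<lambda>_. 0"])
    fix g assume "g \<in> S"
    then obtain C where gC: "g \<in> borel_measurable M" "\<And>s. norm (g s) \<le> C" by (auto simp: S_def)
    show "closedin (weak_topology (L1_space M))
      {F \<in> topspace (weak_topology (L1_space M)). pairing M g F \<in> {..r + (LINT s|M. \<psi> (g s))}}"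
      by (rule closedin_continuous_map_preimage[OF
        continuous_map_weak_topology_dual[OF pairing_in_dual[OF gC]]]) auto
  qed
  ultimately show ?thesis by simp
qed

text \<open>De la Vallee-Poussin argument. \<open>B\<close> bounds the integral of
  \<open>\<phi> (f s) + \<bar>\<psi> 0\<bar>\<close> on the level set, and its final
  \<open>+ 1\<close> keeps it positive. Growth with slope \<open>B / e\<close> is used on
  \<open>A\<close>, and nonnegativity of the shifted integrand off \<open>A\<close>; multiplying the
  result by \<open>e / B\<close> leaves exactly \<open>e\<close>.\<close>

lemma level_set_uniformly_integrable:
  assumes e: "0 < e"
  shows "\<exists>K. \<forall>f. integrable M f \<longrightarrow> ereal_integral M (\<lambda>s. \<phi> (f s)) \<le> ereal r \<longrightarrow>
    (\<forall>A\<in>sets M. (LINT s:A|M. norm (f s)) \<le> e + K * measure M A)"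
proof -
  define B where "B = max 0 (r + \<bar>\<psi> 0\<bar> * measure M (space M)) + 1"
  have B: "B > 0" by (simp add: B_def)
  obtain C where C: "0 \<le> C" "\<And>x. ereal (B / e * norm x - C) \<le> \<phi> x"
    using superlinear[of "B / e"] by blast
  have "(LINT s:A|M. norm (f s)) \<le> e + (C * e / B) * measure M A"
    if f: "integrable M f" and le: "ereal_integral M (\<lambda>s. \<phi> (f s)) \<le> ereal r" and A: "A \<in> sets M" for f A
  proof -
    have "ereal_integral M (\<lambda>s. \<phi> (f s)) < \<infinity>" using le by auto
    note D = integral_lessD[OF borel_measurable_integrable[OF f] this]
    have iA: "integrable M (\<lambda>s. indicat_real A s * norm (f s))"
      using integrable_mult_indicator[OF A integrable_norm[OF f]] by simp
    have iI: "integrable M (indicat_real A)"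
      using A by (simp add: less_top[symmetric] integrable_real_indicator)
    have "AE s in M. B / e * (indicat_real A s * norm (f s)) \<le>
        real_of_ereal (\<phi> (f s)) + \<bar>\<psi> 0\<bar> + C * indicat_real A s"
      using D(1)
    proof eventually_elim
      case (elim s)
      have "ereal (B / e * norm (f s) - C) \<le> ereal (real_of_ereal (\<phi> (f s)))"
        "ereal (- \<bar>\<psi> 0\<bar>) \<le> ereal (real_of_ereal (\<phi> (f s)))"
        using C(2)[of "f s"] lower_bound[of "f s"] elim by simp_all
      then have "B / e * norm (f s) - C \<le> real_of_ereal (\<phi> (f s))" "- \<bar>\<psi> 0\<bar> \<le> real_of_ereal (\<phi> (f s))"
        by (simp_all only: ereal_less_eq(3))
      then show ?case by (auto split: split_indicator)
    qed
    then have "(LINT s|M. B / e * (indicat_real A s * norm (f s))) \<le>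
        (LINT s|M. real_of_ereal (\<phi> (f s)) + \<bar>\<psi> 0\<bar> + C * indicat_real A s)"
      using iA iI D(2) by (intro integral_mono_AE) auto
    also have "\<dots> = (LINT s|M. real_of_ereal (\<phi> (f s))) + \<bar>\<psi> 0\<bar> * measure M (space M) + C * measure M A"
      using iI D(2) A by (simp add: mult.commute)
    also have "\<dots> \<le> B + C * measure M A"
      using D(3) le by (simp add: B_def)
    finally have "B / e * (LINT s:A|M. norm (f s)) \<le> B + C * measure M A"
      by (simp add: set_lebesgue_integral_def)
    then have "e / B * (B / e * (LINT s:A|M. norm (f s))) \<le> e / B * (B + C * measure M A)"
      using e B by (intro mult_left_mono) auto
    then show ?thesis using e B by (simp add: field_simps)
  qed
  then show ?thesis by blast
qed

lemma compactin_level_set: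
  "compactin (weak_topology (L1_space M)) {F \<in> vcarrier (L1_space M). integral_functional M \<phi> F \<le> ereal r}"
proof (rule compactin_weak_topology_L1)
  fix e :: real assume "0 < e"
  from level_set_uniformly_integrable[OF this, of r] obtain K where
    K: "\<And>f A. integrable M f \<Longrightarrow> ereal_integral M (\<lambda>s. \<phi> (f s)) \<le> ereal r \<Longrightarrow> A \<in> sets M \<Longrightarrow>
      (LINT s:A|M. norm (f s)) \<le> e + K * measure M A" by blast
  show "\<exists>K. \<forall>F\<in>{F \<in> vcarrier (L1_space M). integral_functional M \<phi> F \<le> ereal r}. \<forall>A\<in>sets M.
      (LINT s:A|M. norm (ae_rep F s)) \<le> e + K * measure M A"
    using K L1_space_carrierE(1) by (intro exI[of _ K]) (auto simp: integral_functional_def)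
qed (use closedin_level_set in auto)

lemma integral_not_MInfty:
  assumes "f \<in> borel_measurable M"
  shows "ereal_integral M (\<lambda>s. \<phi> (f s)) \<noteq> -\<infinity>"
proof -
  have "ereal_integral M (\<lambda>s. \<phi> (f s)) =
    enn2ereal (\<integral>\<^sup>+s. e2ennreal (\<phi> (f s) + ereal \<bar>\<psi> 0\<bar>) \<partial>M) - ereal (\<bar>\<psi> 0\<bar> * measure M (space M))"
    using assms lower_bound by (intro ereal_integral_shift) auto
  moreover have "0 \<le> enn2ereal (\<integral>\<^sup>+s. e2ennreal (\<phi> (f s) + ereal \<bar>\<psi> 0\<bar>) \<partial>M)" by simp
  ultimately show ?thesis
    by (cases "enn2ereal (\<integral>\<^sup>+s. e2ennreal (\<phi> (f s) + ereal \<bar>\<psi> 0\<bar>) \<partial>M)") auto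
qed

lemma proper_integral_functional: "proper_function (L1_space M) (integral_functional M \<phi>)"
  unfolding proper_function_def
proof
  show "\<forall>F\<in>vcarrier (L1_space M). integral_functional M \<phi> F \<noteq> -\<infinity>"
    unfolding integral_functional_def
    by (intro ballI integral_not_MInfty borel_measurable_integrable L1_space_carrierE(1))
  obtain x where "\<phi> x < \<infinity>" using exists_dom by blast
  then obtain a where a: "\<phi> x = ereal a" using not_MInfty[of x] by (cases "\<phi> x") auto
  have "ereal_integral M (\<lambda>s. \<phi> x) = ereal (LINT s|M. real_of_ereal (\<phi> x))"
    by (rule integral_eqI[of "\<lambda>_. x"]) (simp_all add: a)
  then have "integral_functional M \<phi> (ae_class M (\<lambda>_. x)) < \<infinity>"
    by (subst integral_functional_ae_class) simp_all
  then show "effective_dom (L1_space M) (integral_functional M \<phi>) \<noteq> {}"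
    using ae_class_in_L1_space[of M "\<lambda>_. x"] by (auto simp: effective_dom_def)
qed

text \<open>Different classes have representatives that differ on a set of positive measure. Strict
  convexity acts there and convexity elsewhere, so the integrals differ strictly once the middle one
  is known to be finite.\<close>

lemma strictly_convex_integral_functional:
  "strictly_convex_on_dom (L1_space M) (integral_functional M \<phi>)"
  unfolding strictly_convex_on_dom_def
proof (intro ballI impI)
  fix F G t assume F: "F \<in> effective_dom (L1_space M) (integral_functional M \<phi>)"
    and G: "G \<in> effective_dom (L1_space M) (integral_functional M \<phi>)"
    and t: "t \<in> {0<..<1::real}" and neq: "F \<noteq> G"
  define f where "f = ae_rep F"
  define g where "g = ae_rep G"
  have f: "integrable M f" "ae_class M f = F" "ereal_integral M (\<lambda>s. \<phi> (f s)) < \<infinity>"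
    using F L1_space_carrierE[of F M] by (auto simp: f_def effective_dom_def integral_functional_def)
  have g: "integrable M g" "ae_class M g = G" "ereal_integral M (\<lambda>s. \<phi> (g s)) < \<infinity>"
    using G L1_space_carrierE[of G M] by (auto simp: g_def effective_dom_def integral_functional_def)
  note [measurable] = borel_measurable_integrable[OF f(1)] borel_measurable_integrable[OF g(1)]
  define a where "a s = real_of_ereal (\<phi> (f s))" for s
  define b where "b s = real_of_ereal (\<phi> (g s))" for s
  note fD = integral_lessD[OF _ f(3), folded a_def] and gD = integral_lessD[OF _ g(3), folded b_def]
  have ab: "AE s in M. \<phi> (f s) = ereal (a s)" "AE s in M. \<phi> (g s) = ereal (b s)"
    "integrable M a" "integrable M b" using fD(1,2) gD(1,2) by auto
  define k where "k s = (1 - t) *\<^sub>R f s + t *\<^sub>R g s" for s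
  have k: "integrable M k" using f(1) g(1) unfolding k_def by auto
  note [measurable] = borel_measurable_integrable[OF k]
  have k_eq: "vadd (L1_space M) (vscale (L1_space M) (1 - t) F) (vscale (L1_space M) t G) = ae_class M k"
    using f g unfolding f(2)[symmetric] g(2)[symmetric] k_def
    by (simp add: L1_space_ae_class)
  define c where "c s = (1 - t) * a s + t * b s" for s
  have c: "integrable M c" using ab(3,4) unfolding c_def by auto
  have fin: "AE s in M. \<phi> (k s) = ereal (real_of_ereal (\<phi> (k s))) \<and> real_of_ereal (\<phi> (k s)) \<le> c s \<and>
      (f s \<noteq> g s \<longrightarrow> real_of_ereal (\<phi> (k s)) < c s)"
    using ab(1,2)
  proof eventually_elim
    case (elim s)
    have le: "\<phi> (k s) \<le> ereal (c s)"
      unfolding k_def c_def using elim t by (intro convexD) auto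
    then obtain r where r: "\<phi> (k s) = ereal r" using not_MInfty[of "k s"] by (cases "\<phi> (k s)") auto
    moreover have "\<phi> (k s) < ereal (c s)" if "f s \<noteq> g s"
      unfolding k_def c_def using elim t that by (intro strictD) auto
    ultimately show ?case using le by auto
  qed
  \<comment> \<open>Also true where \<open>\<phi> x\<close> is infinite, since
    \<open>real_of_ereal\<close> gives 0 there.\<close>
  have low: "- \<bar>\<psi> 0\<bar> \<le> real_of_ereal (\<phi> x)" for x
    using lower_bound[of x] by (cases "\<phi> x") auto
  have ik: "integrable M (\<lambda>s. real_of_ereal (\<phi> (k s)))"
  proof (rule Bochner_Integration.integrable_bound)
    show "integrable M (\<lambda>s. \<bar>c s\<bar> + \<bar>\<psi> 0\<bar>)" using c by auto
    show "AE s in M. norm (real_of_ereal (\<phi> (k s))) \<le> norm (\<bar>c s\<bar> + \<bar>\<psi> 0\<bar>)"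
      using fin
    proof eventually_elim
      case (elim s)
      then show ?case unfolding real_norm_def using low[of "k s"] by linarith
    qed
  qed measurable
  have "(LINT s|M. real_of_ereal (\<phi> (k s))) < (LINT s|M. c s)"
  proof (rule integral_less_AE[OF ik c])
    show "{s \<in> space M. f s \<noteq> g s} \<in> sets M" by measurable
    show "emeasure M {s \<in> space M. f s \<noteq> g s} \<noteq> 0"
    proof
      assume "emeasure M {s \<in> space M. f s \<noteq> g s} = 0"
      then have "AE s in M. f s = g s" by (subst AE_iff_measurable[OF _ refl]) auto
      then have "F = G" using f(2) g(2) by (auto dest: ae_class_eqI)
      with neq show False by simp
    qed
    show "AE s in M. s \<in> {s \<in> space M. f s \<noteq> g s} \<longrightarrow> real_of_ereal (\<phi> (k s)) \<noteq> c s"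
      using fin by eventually_elim auto
    show "AE s in M. real_of_ereal (\<phi> (k s)) \<le> c s"
      using fin by eventually_elim auto
  qed
  moreover have "integral_functional M \<phi> (ae_class M k) = ereal (LINT s|M. real_of_ereal (\<phi> (k s)))"
    using fin ik by (subst integral_functional_ae_class) (auto intro!: integral_eqI)
  moreover have "integral_functional M \<phi> F = ereal (LINT s|M. a s)"
    "integral_functional M \<phi> G = ereal (LINT s|M. b s)"
    using fD(3)[OF borel_measurable_integrable[OF f(1)]] gD(3)[OF borel_measurable_integrable[OF g(1)]]
    by (simp_all add: integral_functional_def f_def g_def)
  moreover have "(LINT s|M. c s) = (1 - t) * (LINT s|M. a s) + t * (LINT s|M. b s)"
    using ab(3,4) by (simp add: c_def)
  ultimately show "integral_functional M \<phi>
      (vadd (L1_space M) (vscale (L1_space M) (1 - t) F) (vscale (L1_space M) t G))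
    < ereal (1 - t) * integral_functional M \<phi> F + ereal t * integral_functional M \<phi> G"
    unfolding k_eq by simp
qed

section \<open>The Kadec property\<close>

context
  fixes f :: "'s \<Rightarrow> 'e" and fn :: "nat \<Rightarrow> 's \<Rightarrow> 'e"
  assumes f: "integrable M f" and fn: "\<And>n. integrable M (fn n)"
    and weak: "\<And>g C. g \<in> borel_measurable M \<Longrightarrow> (\<And>s. norm (g s) \<le> C) \<Longrightarrow>
      (\<lambda>n. LINT s|M. fn n s \<bullet> g s) \<longlonglongrightarrow> (LINT s|M. f s \<bullet> g s)"
    and fin: "ereal_integral M (\<lambda>s. \<phi> (f s)) < \<infinity>"
    and fin_n: "\<And>n. ereal_integral M (\<lambda>s. \<phi> (fn n s)) < \<infinity>"
    and lim: "(\<lambda>n. LINT s|M. real_of_ereal (\<phi> (fn n s))) \<longlonglongrightarrow> (LINT s|M. real_of_ereal (\<phi> (f s)))"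
begin

private lemma fm [measurable]: "f \<in> borel_measurable M" "fn n \<in> borel_measurable M"
  using f fn[of n] by auto

private lemma phi_f: "AE s in M. \<phi> (f s) = ereal (real_of_ereal (\<phi> (f s)))"
    "integrable M (\<lambda>s. real_of_ereal (\<phi> (f s)))"
  by (rule integral_lessD[OF fm(1) fin])+

private lemma phi_fn: "AE s in M. \<phi> (fn n s) = ereal (real_of_ereal (\<phi> (fn n s)))"
    "integrable M (\<lambda>s. real_of_ereal (\<phi> (fn n s)))"
  by (rule integral_lessD[OF fm(2) fin_n])+

text \<open>
  Weak lower semicontinuity on the complement of \<open>A\<close>, together with convergence of the total
  integrals, gives upper semicontinuity on \<open>A\<close>.
\<close>

lemma eventually_integral_phi_less:
  assumes A [measurable]: "A \<in> sets M" and c: "(LINT s|M. indicator A s * real_of_ereal (\<phi> (f s))) < c"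
  shows "\<forall>\<^sub>F n in sequentially. (LINT s|M. indicator A s * real_of_ereal (\<phi> (fn n s))) < c"
proof -
  define k where "k s = 1 - indicat_real A s" for s
  have k [measurable]: "k \<in> borel_measurable M" unfolding k_def by measurable
  have k01: "0 \<le> k s" "\<bar>k s\<bar> \<le> 1" "indicat_real A s + k s = 1" for s
    by (auto simp: k_def split: split_indicator)
  have iA: "integrable M (\<lambda>s. indicat_real A s * h s)" "integrable M (\<lambda>s. k s * h s)" if "integrable M h" for h
    using integrable_mult_indicator[OF A that] that by (simp_all add: k_def left_diff_distrib)
  obtain Y where Y [measurable]: "\<And>n. Y n \<in> borel_measurable borel"
    and YC: "\<And>n. \<exists>C. \<forall>x. norm (Y n x) \<le> C"
    and inc: "\<And>x. incseq (\<lambda>n. x \<bullet> Y n x - \<psi> (Y n x))"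
    and low: "\<And>n x. - \<bar>\<psi> 0\<bar> \<le> x \<bullet> Y n x - \<psi> (Y n x)"
    and sup: "\<And>x c. ereal c < \<phi> x \<Longrightarrow> \<exists>n. c < x \<bullet> Y n x - \<psi> (Y n x)"
    using affine_approximation by blast
  define v where "v n x = x \<bullet> Y n x - \<psi> (Y n x)" for n x
  have v_le: "ereal (v n x) \<le> \<phi> x" for n x unfolding v_def by (rule young)
  have [measurable]: "v n \<in> borel_measurable borel" for n unfolding v_def by measurable
  have "(\<lambda>n. LINT s|M. k s * v n (f s)) \<longlonglongrightarrow> (LINT s|M. k s * real_of_ereal (\<phi> (f s)))"
  proof (rule integral_dominated_convergence[where w = "\<lambda>s. \<bar>real_of_ereal (\<phi> (f s))\<bar> + \<bar>\<psi> 0\<bar>"])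
    show "AE s in M. (\<lambda>n. k s * v n (f s)) \<longlonglongrightarrow> k s * real_of_ereal (\<phi> (f s))"
      using phi_f(1)
    proof eventually_elim
      case (elim s)
      have "(\<lambda>n. v n (f s)) \<longlonglongrightarrow> real_of_ereal (\<phi> (f s))"
      proof (rule order_tendstoI)
        fix a assume "a < real_of_ereal (\<phi> (f s))"
        then have "ereal a < \<phi> (f s)" using elim by (metis ereal_less_eq(3) not_less)
        then obtain N where "a < v N (f s)" using sup unfolding v_def by blast
        then show "\<forall>\<^sub>F n in sequentially. a < v n (f s)"
          using incseqD[OF inc[of "f s"]] unfolding v_def eventually_sequentially by (meson less_le_trans)
      next
        fix a assume a: "real_of_ereal (\<phi> (f s)) < a"
        have "v n (f s) \<le> real_of_ereal (\<phi> (f s))" for n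
          using v_le[of n "f s"] elim by (metis ereal_less_eq(3))
        then show "\<forall>\<^sub>F n in sequentially. v n (f s) < a"
          using a by (intro always_eventually allI) (rule le_less_trans)
      qed
      then show ?case by (rule tendsto_mult_left)
    qed
    show "AE s in M. norm (k s * v n (f s)) \<le> \<bar>real_of_ereal (\<phi> (f s))\<bar> + \<bar>\<psi> 0\<bar>" for n
      using phi_f(1)
    proof eventually_elim
      case (elim s)
      have "v n (f s) \<le> real_of_ereal (\<phi> (f s))"
        using v_le[of n "f s"] elim by (metis ereal_less_eq(3))
      moreover have "- \<bar>\<psi> 0\<bar> \<le> v n (f s)" unfolding v_def by (rule low)
      ultimately have "\<bar>v n (f s)\<bar> \<le> \<bar>real_of_ereal (\<phi> (f s))\<bar> + \<bar>\<psi> 0\<bar>" by linarith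
      moreover have "\<bar>k s\<bar> * \<bar>v n (f s)\<bar> \<le> 1 * \<bar>v n (f s)\<bar>"
        by (intro mult_right_mono k01) auto
      ultimately show ?case by (simp add: abs_mult)
    qed
    show "integrable M (\<lambda>s. \<bar>real_of_ereal (\<phi> (f s))\<bar> + \<bar>\<psi> 0\<bar>)"
      by (intro Bochner_Integration.integrable_add integrable_abs phi_f(2)) simp
  qed measurable
  moreover have "(LINT s|M. real_of_ereal (\<phi> (f s))) - c < (LINT s|M. k s * real_of_ereal (\<phi> (f s)))"
    using c iA[OF phi_f(2)] phi_f(2) by (simp add: k_def left_diff_distrib)
  ultimately have "\<forall>\<^sub>F n in sequentially. (LINT s|M. real_of_ereal (\<phi> (f s))) - c < (LINT s|M. k s * v n (f s))"
    by (rule order_tendstoD(1))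
  then obtain N where N: "(LINT s|M. real_of_ereal (\<phi> (f s))) - c < (LINT s|M. k s * v N (f s))"
    by (auto simp: eventually_sequentially)
  obtain C where C: "\<And>x. norm (Y N x) \<le> C" using YC by blast
  \<comment> \<open>The slope is frozen at \<open>f\<close>: along \<open>fn n\<close> the same
    minorant is a pairing with a fixed bounded function, so \<open>weak\<close> applies to it, while
    Young's inequality still bounds it by \<open>\<phi> (fn n s)\<close>.\<close>
  define g where "g s = k s *\<^sub>R Y N (f s)" for s
  define q where "q s = k s * \<psi> (Y N (f s))" for s
  have gm: "g \<in> borel_measurable M" unfolding g_def by measurable
  have gC: "norm (g s) \<le> C" for s
  proof -
    have "norm (g s) \<le> 1 * norm (Y N (f s))"
      unfolding g_def norm_scaleR by (intro mult_right_mono k01) auto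
    then show ?thesis using C[of "f s"] by simp
  qed
  have "integrable M (\<lambda>s. \<psi> (Y N (f s)))" by (rule integrable_psi[OF _ C]) measurable
  from iA(2)[OF this] have q: "integrable M q" by (simp add: q_def[abs_def])
  note ig = integrable_inner_bounded[OF _ gm gC]
  have kv: "k s * v N (f s) = f s \<bullet> g s - q s" for s
    by (simp add: v_def g_def q_def right_diff_distrib)
  have bound: "(LINT s|M. indicator A s * real_of_ereal (\<phi> (fn n s))) \<le>
      (LINT s|M. real_of_ereal (\<phi> (fn n s))) - ((LINT s|M. fn n s \<bullet> g s) - (LINT s|M. q s))" for n
  proof -
    have "AE s in M. indicator A s * real_of_ereal (\<phi> (fn n s)) + (fn n s \<bullet> g s - q s) \<le>
        real_of_ereal (\<phi> (fn n s))"
      using phi_fn(1)[of n]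
    proof eventually_elim
      case (elim s)
      have "fn n s \<bullet> Y N (f s) - \<psi> (Y N (f s)) \<le> real_of_ereal (\<phi> (fn n s))"
        using young[of "fn n s" "Y N (f s)"] elim by (metis ereal_less_eq(3))
      then have "k s * (fn n s \<bullet> Y N (f s) - \<psi> (Y N (f s))) \<le> k s * real_of_ereal (\<phi> (fn n s))"
        by (intro mult_left_mono k01)
      then show ?case
        by (auto simp: g_def q_def k_def split: split_indicator)
    qed
    then have "(LINT s|M. indicator A s * real_of_ereal (\<phi> (fn n s)) + (fn n s \<bullet> g s - q s)) \<le>
        (LINT s|M. real_of_ereal (\<phi> (fn n s)))"
      using iA(1)[OF phi_fn(2)[of n]] ig[OF fn[of n]] q phi_fn(2)[of n]
      by (intro integral_mono_AE) auto
    then show ?thesis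
      using iA(1)[OF phi_fn(2)[of n]] ig[OF fn[of n]] q by simp
  qed
  have "(\<lambda>n. (LINT s|M. real_of_ereal (\<phi> (fn n s))) - ((LINT s|M. fn n s \<bullet> g s) - (LINT s|M. q s)))
    \<longlonglongrightarrow> (LINT s|M. real_of_ereal (\<phi> (f s))) - ((LINT s|M. f s \<bullet> g s) - (LINT s|M. q s))"
    by (intro tendsto_intros lim weak[OF gm gC])
  moreover have "(LINT s|M. real_of_ereal (\<phi> (f s))) - ((LINT s|M. f s \<bullet> g s) - (LINT s|M. q s)) < c"
    using N ig[OF f] q by (simp add: kv)
  ultimately have "\<forall>\<^sub>F n in sequentially.
      (LINT s|M. real_of_ereal (\<phi> (fn n s))) - ((LINT s|M. fn n s \<bullet> g s) - (LINT s|M. q s)) < c"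
    by (rule order_tendstoD(2))
  then show ?thesis by eventually_elim (rule le_less_trans[OF bound])
qed

text \<open>The slack in \<open>young\<close>, a stand-in for a Bregman distance. It is meaningful
  only where \<open>\<phi> (h s)\<close> is finite.\<close>

private definition gap :: "'e \<Rightarrow> ('s \<Rightarrow> 'e) \<Rightarrow> 's \<Rightarrow> real" where
  "gap y h s = real_of_ereal (\<phi> (h s)) - h s \<bullet> y + \<psi> y"

private lemma gap_nonneg:
  assumes "\<phi> (h s) = ereal (real_of_ereal (\<phi> (h s)))"
  shows "0 \<le> gap y h s"
proof -
  have "ereal (h s \<bullet> y - \<psi> y) \<le> ereal (real_of_ereal (\<phi> (h s)))"
    unfolding assms[symmetric] by (rule young)
  then show ?thesis unfolding gap_def ereal_less_eq(3) by linarith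
qed

private lemma integrable_gap:
  assumes "integrable M h" "integrable M (\<lambda>s. real_of_ereal (\<phi> (h s)))" "A \<in> sets M"
  shows "integrable M (\<lambda>s. indicator A s * gap y h s)"
    "(LINT s|M. indicator A s * gap y h s) = (LINT s|M. indicator A s * real_of_ereal (\<phi> (h s)))
      - (LINT s|M. h s \<bullet> (indicator A s *\<^sub>R y)) + \<psi> y * measure M A"
proof -
  have 1: "integrable M (\<lambda>s. indicat_real A s * real_of_ereal (\<phi> (h s)))"
    using integrable_mult_indicator[OF assms(3,2)] by simp
  have 2: "integrable M (\<lambda>s. h s \<bullet> (indicat_real A s *\<^sub>R y))"
    using integrable_mult_indicator[OF assms(3) integrable_inner_left[of y M h]] assms(1) by simp
  have 3: "integrable M (\<lambda>s. \<psi> y * indicat_real A s)"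
    using assms(3) by (intro integrable_mult_right integrable_real_indicator) (simp_all add: less_top[symmetric])
  have eq: "indicator A s * gap y h s = indicat_real A s * real_of_ereal (\<phi> (h s)) -
      h s \<bullet> (indicat_real A s *\<^sub>R y) + \<psi> y * indicat_real A s" for s
    by (simp add: gap_def algebra_simps)
  show "integrable M (\<lambda>s. indicator A s * gap y h s)"
    unfolding eq using 1 2 3 by (intro Bochner_Integration.integrable_add Bochner_Integration.integrable_diff)
  show "(LINT s|M. indicator A s * gap y h s) = (LINT s|M. indicator A s * real_of_ereal (\<phi> (h s)))
      - (LINT s|M. h s \<bullet> (indicator A s *\<^sub>R y)) + \<psi> y * measure M A"
    unfolding eq Bochner_Integration.integral_add[OF Bochner_Integration.integrable_diff[OF 1 2] 3]
      Bochner_Integration.integral_diff[OF 1 2]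
    using assms(3) by simp
qed

private lemma eventually_integral_gap_less:
  assumes A [measurable]: "A \<in> sets M" and c: "(LINT s|M. indicator A s * gap y f s) < c"
  shows "\<forall>\<^sub>F n in sequentially. (LINT s|M. indicator A s * gap y (fn n) s) < c"
proof -
  let ?a = "LINT s|M. indicator A s * real_of_ereal (\<phi> (f s))"
    and ?b = "LINT s|M. f s \<bullet> (indicat_real A s *\<^sub>R y)"
  \<comment> \<open>Half of the slack goes to the \<phi> term and half to the linear term.\<close>
  define d where "d = (c - (LINT s|M. indicator A s * gap y f s)) / 2"
  have d: "d > 0" using c by (simp add: d_def)
  have eq: "c = ?a - ?b + \<psi> y * measure M A + 2 * d"
  proof -
    have "2 * d = c - (LINT s|M. indicator A s * gap y f s)" by (simp add: d_def)
    then show ?thesis using integrable_gap(2)[OF f phi_f(2) A, of y] by linarith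
  qed
  have "(\<lambda>n. LINT s|M. fn n s \<bullet> (indicat_real A s *\<^sub>R y)) \<longlonglongrightarrow> ?b"
  proof (rule weak[of _ "norm y"])
    show "norm (indicat_real A s *\<^sub>R y) \<le> norm y" for s by (auto split: split_indicator)
  qed measurable
  then have "\<forall>\<^sub>F n in sequentially. ?b - d < (LINT s|M. fn n s \<bullet> (indicat_real A s *\<^sub>R y))"
    using d by (intro order_tendstoD(1)) auto
  moreover have "\<forall>\<^sub>F n in sequentially. (LINT s|M. indicator A s * real_of_ereal (\<phi> (fn n s))) < ?a + d"
    using d by (intro eventually_integral_phi_less) auto
  ultimately show ?thesis
  proof eventually_elim
    case (elim n)
    then show ?case unfolding integrable_gap(2)[OF fn phi_fn(2) A] eq by linarith
  qed
qed

text \<open>Markov's inequality for the gap. A deviation of at least \<epsilon> puts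
  \<open>fn n s\<close> into the half-space, where the gap is at least \<eta>, while along
  \<open>f\<close> the gap on \<open>A\<close> is at most \<theta> \<eta>; dividing the integral
  bound by \<eta> gives the estimate.\<close>

private lemma eventually_measure_deviation_less:
  assumes A [measurable]: "A \<in> sets M" and \<theta>: "0 < \<theta>" and \<delta>: "0 < \<delta>"
    and half: "\<And>w. t \<le> u \<bullet> w \<Longrightarrow> ereal (w \<bullet> y - b) \<le> \<phi> w"
    and fA: "\<And>s. s \<in> A \<Longrightarrow> \<phi> (f s) = ereal (real_of_ereal (\<phi> (f s)))"
    and tA: "\<And>s. s \<in> A \<Longrightarrow> t \<le> u \<bullet> f s + \<epsilon>"
    and gA: "\<And>s. s \<in> A \<Longrightarrow> \<theta> * b + (1 - \<theta>) * \<psi> y < f s \<bullet> y - real_of_ereal (\<phi> (f s))"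
  shows "\<forall>\<^sub>F n in sequentially. measure M (A \<inter> {s \<in> space M. \<epsilon> \<le> u \<bullet> (fn n s - f s)}) < \<theta> * measure M A + \<delta>"
proof (cases "A = {}")
  case True
  then show ?thesis using \<delta> by simp
next
  case False
  \<comment> \<open>One point of \<open>A\<close> shows \<eta> > 0: its gap is nonnegative and below
    \<theta> \<eta>.\<close>
  then obtain s0 where s0: "s0 \<in> A" by blast
  define \<eta> where "\<eta> = \<psi> y - b"
  have gap_le: "gap y f s \<le> \<theta> * \<eta>" if "s \<in> A" for s
    using gA[OF that] by (simp add: gap_def \<eta>_def algebra_simps)
  have "gap y f s0 < \<theta> * \<eta>" using gA[OF s0] by (simp add: gap_def \<eta>_def algebra_simps)
  with gap_nonneg[where h = f and s = s0 and y = y, OF fA[OF s0]] have "0 < \<theta> * \<eta>" by linarith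
  with \<theta> have \<eta>: "0 < \<eta>" by (simp add: zero_less_mult_iff)
  have iI: "integrable M (\<lambda>s. r * indicat_real B s)" if "B \<in> sets M" for B r
    using that by (intro integrable_mult_right integrable_real_indicator) (simp_all add: less_top[symmetric])
  have "(LINT s|M. indicator A s * gap y f s) \<le> (LINT s|M. \<theta> * \<eta> * indicat_real A s)"
    using gap_le by (intro integral_mono integrable_gap(1)[OF f phi_f(2) A] iI[OF A])
      (auto split: split_indicator)
  also have "\<dots> = \<eta> * (\<theta> * measure M A)" using A by simp
  also have "\<dots> < \<eta> * (\<theta> * measure M A + \<delta>)" using \<eta> \<delta> by simp
  finally have "\<forall>\<^sub>F n in sequentially. (LINT s|M. indicator A s * gap y (fn n) s) < \<eta> * (\<theta> * measure M A + \<delta>)"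
    by (rule eventually_integral_gap_less[OF A])
  then show ?thesis
  proof eventually_elim
    case (elim n)
    define B where "B = A \<inter> {s \<in> space M. \<epsilon> \<le> u \<bullet> (fn n s - f s)}"
    have B [measurable]: "B \<in> sets M" unfolding B_def by measurable
    have "AE s in M. \<eta> * indicat_real B s \<le> indicator A s * gap y (fn n) s"
      using phi_fn(1)[of n]
    proof eventually_elim
      case (elim s)
      show ?case
      proof (cases "s \<in> B")
        case True
        then have "s \<in> A" "\<epsilon> \<le> u \<bullet> fn n s - u \<bullet> f s" by (auto simp: B_def inner_diff_right)
        with tA[of s] have "t \<le> u \<bullet> fn n s" by linarith
        from half[OF this] have "fn n s \<bullet> y - b \<le> real_of_ereal (\<phi> (fn n s))"
          using elim by (metis ereal_less_eq(3))
        then show ?thesis using True \<open>s \<in> A\<close> by (simp add: gap_def \<eta>_def)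
      next
        case False
        then show ?thesis using gap_nonneg[where h = "fn n" and s = s and y = y, OF elim] by (simp split: split_indicator)
      qed
    qed
    then have "(LINT s|M. \<eta> * indicat_real B s) \<le> (LINT s|M. indicator A s * gap y (fn n) s)"
      by (intro integral_mono_AE iI[OF B] integrable_gap(1)[OF fn phi_fn(2) A])
    also note elim
    finally have "\<eta> * measure M B < \<eta> * (\<theta> * measure M A + \<delta>)" using B by simp
    then show ?case using \<eta> by (simp add: B_def)
  qed
qed

lemma eventually_measure_deviation:
  assumes \<epsilon>: "0 < \<epsilon>" and \<kappa>: "0 < \<kappa>"
  shows "\<forall>\<^sub>F n in sequentially. measure M {s \<in> space M. \<epsilon> \<le> u \<bullet> (fn n s - f s)} < \<kappa>"
proof -
  define m where "m = measure M (space M)"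
  have m: "0 \<le> m" by (simp add: m_def)
  \<comment> \<open>The final bound consists of three terms of at most \<kappa> / 4: \<theta> times
    the total mass, the uncovered remainder \<open>R\<close>, and the summed errors
    \<open>\<kappa> / (4 * real (Suc N))\<close>. The \<open>1 / 2\<close> keeps \<theta> below
    1.\<close>
  define \<theta> where "\<theta> = min (1 / 2) (\<kappa> / (4 * (m + 1)))"
  have \<theta>: "0 < \<theta>" "\<theta> < 1" using \<kappa> m by (auto simp: \<theta>_def)
  have "\<theta> * m \<le> \<kappa> / (4 * (m + 1)) * (m + 1)"
    using m \<kappa> by (intro mult_mono) (auto simp: \<theta>_def)
  also have "\<dots> = \<kappa> / 4" using m by (simp add: field_simps)
  finally have \<theta>m: "\<theta> * m \<le> \<kappa> / 4" .
  obtain D :: "'e set" where D: "countable D" "\<And>U. open U \<Longrightarrow> U \<noteq> {} \<Longrightarrow> \<exists>d\<in>D. d \<in> U"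
    by (rule countable_dense_setE) (rule that)
  define J where "J = {(y, t, b). y \<in> D \<and> t \<in> \<rat> \<and> b \<in> \<rat> \<and>
    (\<forall>w. t \<le> u \<bullet> w \<longrightarrow> ereal (w \<bullet> y - b) \<le> \<phi> w)}"
  define E where "E = (\<lambda>(y, t, b). {s \<in> space M. \<phi> (f s) = ereal (real_of_ereal (\<phi> (f s))) \<and>
    u \<bullet> f s < t \<and> t \<le> u \<bullet> f s + \<epsilon> \<and>
    \<theta> * b + (1 - \<theta>) * \<psi> y < f s \<bullet> y - real_of_ereal (\<phi> (f s))})"
  have E_sets: "E j \<in> sets M" for j
    unfolding E_def by (cases j) (simp only: prod.case, measurable)
  have "countable J"
  proof (rule countable_subset)
    show "J \<subseteq> D \<times> \<rat> \<times> \<rat>" by (auto simp: J_def)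
    show "countable (D \<times> (\<rat>::real set) \<times> (\<rat>::real set))" using D(1) countable_rat by (intro countable_SIGMA) auto
  qed
  have cover: "\<exists>j\<in>J. s \<in> E j" if s: "s \<in> space M" "\<phi> (f s) = ereal (real_of_ereal (\<phi> (f s)))" for s
  proof -
    \<comment> \<open>The lower inequality keeps \<open>f s\<close> outside the half-space; the
      upper one makes every deviation of at least \<epsilon> land inside it.\<close>
    obtain t where t: "t \<in> \<rat>" "u \<bullet> f s < t" "t < u \<bullet> f s + \<epsilon>"
      using Rats_dense_in_real[of "u \<bullet> f s" "u \<bullet> f s + \<epsilon>"] \<epsilon> by auto
    from half_space_gap_dense[OF s(2) t(2) \<theta> D(2)] obtain y b where
      "y \<in> D" "b \<in> \<rat>" "\<And>w. t \<le> u \<bullet> w \<Longrightarrow> ereal (w \<bullet> y - b) \<le> \<phi> w"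
      "\<theta> * b + (1 - \<theta>) * \<psi> y < f s \<bullet> y - real_of_ereal (\<phi> (f s))"
      by metis
    then have "(y, t, b) \<in> J" "s \<in> E (y, t, b)"
      using s t by (auto simp: J_def E_def)
    then show ?thesis by blast
  qed
  define F where "F k = (if J = {} then {} else E (from_nat_into J k))" for k
  have F_sets [measurable]: "F k \<in> sets M" for k
    by (simp add: F_def E_sets)
  have F_cover: "AE s in M. s \<in> (\<Union>k. F k)"
    using phi_f(1) AE_space
  proof eventually_elim
    case (elim s)
    then obtain j where j: "j \<in> J" "s \<in> E j" using cover by blast
    then obtain k where "from_nat_into J k = j"
      using from_nat_into_surj[OF \<open>countable J\<close>] by blast
    with j show ?case by (auto simp: F_def)
  qed
  \<comment> \<open>Disjoint pieces, so that the terms \<open>\<theta> * measure M (F' k)\<close>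
    sum to at most \<theta> times the total mass.\<close>
  define F' where "F' = disjointed F"
  have F'_sets [measurable]: "F' k \<in> sets M" for k
  proof -
    have "range F \<subseteq> sets M" by (intro image_subsetI F_sets)
    from sets.range_disjointed_sets[OF this] show ?thesis by (auto simp: F'_def)
  qed
  have F'_disj: "disjoint_family F'" unfolding F'_def by (rule disjoint_family_disjointed)
  have F'_UN: "(\<Union>k. F' k) = (\<Union>k. F k)" unfolding F'_def by (rule UN_disjointed_eq)
  have F'_sub: "F' k \<subseteq> F k" for k unfolding F'_def by (rule disjointed_subset)
  have "(\<lambda>N. measure M (\<Union>k<N. F' k)) \<longlonglongrightarrow> measure M (\<Union>N. \<Union>k<N. F' k)"
  proof (rule finite_Lim_measure_incseq)
    show "incseq (\<lambda>N. \<Union>k<N. F' k)" by (intro incseq_SucI UN_mono) auto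
  qed auto
  moreover have "measure M (\<Union>N. \<Union>k<N. F' k) = m"
  proof -
    have "(\<Union>N. \<Union>k<N. F' k) = (\<Union>k. F k)" unfolding F'_UN[symmetric] by blast
    then show ?thesis unfolding m_def using F_cover AE_space
      by (intro measure_eq_AE) auto
  qed
  ultimately have "\<forall>\<^sub>F N in sequentially. m - \<kappa> / 4 < measure M (\<Union>k<N. F' k)"
    using \<kappa> by (intro order_tendstoD(1)) auto
  then obtain N where N: "m - \<kappa> / 4 < measure M (\<Union>k<N. F' k)"
    by (auto simp: eventually_sequentially)
  define R where "R = space M - (\<Union>k<N. F' k)"
  have R [measurable]: "R \<in> sets M" unfolding R_def by measurable
  have R_small: "measure M R < \<kappa> / 4"
    using N unfolding R_def m_def by (subst finite_measure_compl) auto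
  define B where "B n = {s \<in> space M. \<epsilon> \<le> u \<bullet> (fn n s - f s)}" for n
  have B [measurable]: "B n \<in> sets M" for n unfolding B_def by measurable
  have "\<forall>\<^sub>F n in sequentially. measure M (F' k \<inter> B n) < \<theta> * measure M (F' k) + \<kappa> / (4 * real (Suc N))" for k
  proof (cases "J = {}")
    case True
    then have "F' k = {}" using F'_sub[of k] by (auto simp: F_def)
    then show ?thesis using \<kappa> by (auto intro!: always_eventually divide_pos_pos)
  next
    case False
    obtain y t b where j: "from_nat_into J k = (y, t, b)" by (metis prod_cases3)
    then have J: "(y, t, b) \<in> J" using from_nat_into[OF False, of k] by simp
    have sub: "F' k \<subseteq> E (y, t, b)" using F'_sub[of k] False j by (simp add: F_def)
    show ?thesis unfolding B_def
    proof (rule eventually_measure_deviation_less[OF F'_sets \<theta>(1), of _ t u y b])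
      show "0 < \<kappa> / (4 * real (Suc N))" using \<kappa> by (intro divide_pos_pos) auto
      show "ereal (w \<bullet> y - b) \<le> \<phi> w" if "t \<le> u \<bullet> w" for w using J that by (auto simp: J_def)
    qed (use sub in \<open>auto simp: E_def\<close>)
  qed
  then have "\<forall>\<^sub>F n in sequentially. \<forall>k\<in>{..<N}.
      measure M (F' k \<inter> B n) < \<theta> * measure M (F' k) + \<kappa> / (4 * real (Suc N))"
    by (intro eventually_ball_finite) auto
  then show ?thesis
  proof (rule eventually_mono, goal_cases)
    case (1 n)
    have "measure M (B n) \<le> measure M (R \<union> (\<Union>k<N. F' k \<inter> B n))"
      using sets.sets_into_space[OF B] by (intro finite_measure_mono) (auto simp: R_def)
    also have "\<dots> \<le> measure M R + measure M (\<Union>k<N. F' k \<inter> B n)"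
      by (intro measure_Un_le) auto
    also have "measure M (\<Union>k<N. F' k \<inter> B n) \<le> (\<Sum>k<N. measure M (F' k \<inter> B n))"
      by (intro finite_measure_subadditive_finite) auto
    also have "\<dots> \<le> (\<Sum>k<N. \<theta> * measure M (F' k) + \<kappa> / (4 * real (Suc N)))"
      by (intro sum_mono less_imp_le) (rule bspec[OF 1])
    also have "\<dots> = \<theta> * (\<Sum>k<N. measure M (F' k)) + real N * (\<kappa> / (4 * real (Suc N)))"
      by (simp add: sum.distrib sum_distrib_left)
    also have "(\<Sum>k<N. measure M (F' k)) = measure M (\<Union>k<N. F' k)"
      using F'_disj by (intro finite_measure_finite_Union[symmetric])
        (auto intro: disjoint_family_on_mono)
    also have "\<theta> * measure M (\<Union>k<N. F' k) \<le> \<theta> * m"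
      unfolding m_def using \<theta> by (intro mult_left_mono bounded_measure) auto
    also have "real N * (\<kappa> / (4 * real (Suc N))) \<le> real (Suc N) * (\<kappa> / (4 * real (Suc N)))"
      using \<kappa> by (intro mult_right_mono) auto
    also have "\<dots> = \<kappa> / 4" by (simp del: of_nat_Suc)
    finally show "measure M {s \<in> space M. \<epsilon> \<le> u \<bullet> (fn n s - f s)} < \<kappa>"
      using R_small \<theta>m \<kappa> unfolding B_def by linarith
  qed
qed

text \<open>Vitali's argument for each signed coordinate: outside the deviation set the positive
  part is below \<epsilon>, and on it uniform integrability of the common level set bounds both
  norms. The norm is then dominated by the sum over the directions \<open>i\<close> and
  \<open>- i\<close>.\<close>

lemma L1_convergence:
  assumes le: "ereal_integral M (\<lambda>s. \<phi> (f s)) \<le> ereal r" "\<And>n. ereal_integral M (\<lambda>s. \<phi> (fn n s)) \<le> ereal r"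
  shows "(\<lambda>n. LINT s|M. norm (fn n s - f s)) \<longlonglongrightarrow> 0"
proof -
  have conv: "(\<lambda>n. LINT s|M. max 0 (u \<bullet> (fn n s - f s))) \<longlonglongrightarrow> 0" if u: "norm u = 1" for u
  proof (rule order_tendstoI)
    fix a :: real assume "a < 0"
    then show "\<forall>\<^sub>F n in sequentially. a < (LINT s|M. max 0 (u \<bullet> (fn n s - f s)))"
      by (intro always_eventually allI) (auto intro!: less_le_trans[OF _ integral_nonneg_AE])
  next
    fix a :: real assume a: "0 < a"
    define m where "m = measure M (space M)"
    have m: "0 \<le> m" by (simp add: m_def)
    obtain K0 where K0: "\<And>h A. integrable M h \<Longrightarrow> ereal_integral M (\<lambda>s. \<phi> (h s)) \<le> ereal r \<Longrightarrow> A \<in> sets M \<Longrightarrow>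
        (LINT s:A|M. norm (h s)) \<le> a / 8 + K0 * measure M A"
      using level_set_uniformly_integrable[of "a / 8" r] a by (metis divide_pos_pos zero_less_numeral)
    \<comment> \<open>Made positive for the division in \<open>a / (8 * K)\<close>. With this
      threshold each of the two norms contributes at most \<open>a / 8 + a / 8\<close> and
      \<epsilon> at most \<open>a / 4\<close>, in total \<open>3 * a / 4\<close>.\<close>
    define K where "K = \<bar>K0\<bar> + 1"
    have K_pos: "0 < K" by (simp add: K_def add_nonneg_pos)
    have K: "(LINT s:A|M. norm (h s)) \<le> a / 8 + K * measure M A"
      if "integrable M h" "ereal_integral M (\<lambda>s. \<phi> (h s)) \<le> ereal r" "A \<in> sets M" for h A
    proof -
      have "K0 * measure M A \<le> K * measure M A" by (intro mult_right_mono) (auto simp: K_def)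
      with K0[OF that] show ?thesis by linarith
    qed
    define \<epsilon> where "\<epsilon> = a / (4 * (m + 1))"
    have \<epsilon>: "0 < \<epsilon>" using a m by (simp add: \<epsilon>_def)
    have \<epsilon>m: "\<epsilon> * m \<le> a / 4"
    proof -
      have "\<epsilon> * m \<le> \<epsilon> * (m + 1)" using \<epsilon> by simp
      also have "\<dots> = a / 4" using m by (simp add: \<epsilon>_def field_simps)
      finally show ?thesis .
    qed
    have "0 < a / (8 * K)" using a by (simp add: K_def add_nonneg_pos)
    from eventually_measure_deviation[OF \<epsilon> this, of u]
    show "\<forall>\<^sub>F n in sequentially. (LINT s|M. max 0 (u \<bullet> (fn n s - f s))) < a"
    proof eventually_elim
      case (elim n)
      define B where "B = {s \<in> space M. \<epsilon> \<le> u \<bullet> (fn n s - f s)}"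
      have B [measurable]: "B \<in> sets M" unfolding B_def by measurable
      have iB: "integrable M (\<lambda>s. indicat_real B s * norm (h s))" if "integrable M h" for h :: "'s \<Rightarrow> 'e"
        using integrable_mult_indicator[OF B integrable_norm[OF that]] by simp
      have "(LINT s|M. max 0 (u \<bullet> (fn n s - f s))) \<le>
          (LINT s|M. \<epsilon> + (indicat_real B s * norm (fn n s) + indicat_real B s * norm (f s)))"
      proof (rule integral_mono)
        show "integrable M (\<lambda>s. max 0 (u \<bullet> (fn n s - f s)))" using f fn[of n] by (intro integrable_max) auto
        show "integrable M (\<lambda>s. \<epsilon> + (indicat_real B s * norm (fn n s) + indicat_real B s * norm (f s)))"
          using iB[OF f] iB[OF fn[of n]] by auto
        fix s assume s: "s \<in> space M"
        show "max 0 (u \<bullet> (fn n s - f s)) \<le> \<epsilon> + (indicat_real B s * norm (fn n s) + indicat_real B s * norm (f s))"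
        proof (cases "s \<in> B")
          case True
          have "u \<bullet> (fn n s - f s) \<le> norm u * norm (fn n s - f s)" by (rule norm_cauchy_schwarz)
          also have "\<dots> \<le> norm (fn n s) + norm (f s)" using u norm_triangle_ineq4[of "fn n s" "f s"] by simp
          finally show ?thesis using True \<epsilon> by (auto intro: add_nonneg_nonneg)
        next
          case False
          then show ?thesis using s \<epsilon> by (simp add: B_def)
        qed
      qed
      also have "\<dots> = \<epsilon> * m + ((LINT s:B|M. norm (fn n s)) + (LINT s:B|M. norm (f s)))"
        using iB[OF f] iB[OF fn[of n]] by (simp add: m_def set_lebesgue_integral_def mult.commute)
      also have "\<dots> \<le> a / 4 + ((a / 8 + K * measure M B) + (a / 8 + K * measure M B))"
        by (intro add_mono \<epsilon>m K f fn le B)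
      also have "K * measure M B < K * (a / (8 * K))"
        using elim by (intro mult_strict_left_mono) (auto simp: B_def K_def)
      also have "K * (a / (8 * K)) = a / 8" using K_pos by simp
      finally show ?case using a by linarith
    qed
  qed
  have i_max: "integrable M (\<lambda>s. max 0 (u \<bullet> (fn n s - f s)))" for u n
    using f fn[of n] by (intro integrable_max) auto
  let ?S = "\<lambda>n. \<Sum>i\<in>Basis. (LINT s|M. max 0 (i \<bullet> (fn n s - f s))) + (LINT s|M. max 0 ((- i) \<bullet> (fn n s - f s)))"
  have "?S \<longlonglongrightarrow> (\<Sum>i\<in>(Basis::'e set). 0 + 0)"
    by (intro tendsto_sum tendsto_add conv) auto
  then have S: "?S \<longlonglongrightarrow> 0" by simp
  show ?thesis
  proof (rule Lim_null_comparison[OF always_eventually S], intro allI)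
    fix n
    have "(LINT s|M. norm (fn n s - f s)) \<le>
        (LINT s|M. (\<Sum>i\<in>Basis. max 0 (i \<bullet> (fn n s - f s)) + max 0 ((- i) \<bullet> (fn n s - f s))))"
    proof (rule integral_mono)
      show "integrable M (\<lambda>s. norm (fn n s - f s))" using f fn[of n] by auto
      show "integrable M (\<lambda>s. \<Sum>i\<in>Basis. max 0 (i \<bullet> (fn n s - f s)) + max 0 ((- i) \<bullet> (fn n s - f s)))"
        by (intro Bochner_Integration.integrable_sum Bochner_Integration.integrable_add i_max)
      fix s
      have "norm (fn n s - f s) \<le> (\<Sum>i\<in>Basis. \<bar>(fn n s - f s) \<bullet> i\<bar>)" by (rule norm_le_l1)
      also have "\<dots> = (\<Sum>i\<in>Basis. max 0 (i \<bullet> (fn n s - f s)) + max 0 ((- i) \<bullet> (fn n s - f s)))"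
        by (intro sum.cong) (auto simp: inner_commute)
      finally show "norm (fn n s - f s) \<le>
        (\<Sum>i\<in>Basis. max 0 (i \<bullet> (fn n s - f s)) + max 0 ((- i) \<bullet> (fn n s - f s)))" .
    qed
    also have "\<dots> = ?S n"
      by (subst Bochner_Integration.integral_sum)
        (intro Bochner_Integration.integrable_add i_max sum.cong refl Bochner_Integration.integral_add)+
    finally show "norm (LINT s|M. norm (fn n s - f s)) \<le> ?S n" by simp
  qed
qed

end

section \<open>From representatives back to classes, and the final assembly\<close>

lemma kadec_integral_functional: "kadec_property (L1_space M) (integral_functional M \<phi>)"
  unfolding kadec_property_def
proof (intro allI impI, elim conjE)
  fix xs F
  assume xs: "\<forall>n. xs n \<in> vcarrier (L1_space M)"
    and F: "F \<in> effective_dom (L1_space M) (integral_functional M \<phi>)"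
    and weak: "limitin (weak_topology (L1_space M)) xs F sequentially"
    and lim: "(\<lambda>n. integral_functional M \<phi> (xs n)) \<longlonglongrightarrow> integral_functional M \<phi> F"
  define f where "f = ae_rep F"
  have f: "integrable M f" "ae_class M f = F" "ereal_integral M (\<lambda>s. \<phi> (f s)) < \<infinity>"
    using F L1_space_carrierE[of F M] by (auto simp: f_def effective_dom_def integral_functional_def)
  define a where "a = (LINT s|M. real_of_ereal (\<phi> (f s)))"
  have fD: "ereal_integral M (\<lambda>s. \<phi> (f s)) = ereal a"
    unfolding a_def by (rule integral_lessD[OF borel_measurable_integrable[OF f(1)] f(3)])
  have "integral_functional M \<phi> F < ereal (a + 1)"
    using fD by (simp add: integral_functional_def f_def)
  with lim have "\<forall>\<^sub>F n in sequentially. integral_functional M \<phi> (xs n) < ereal (a + 1)"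
    by (rule order_tendstoD(2))
  \<comment> \<open>Early terms may have infinite value. Past \<open>N\<close> all values lie below
    \<open>a + 1\<close>, which gives finiteness and one common level for uniform integrability; the
    discarded terms do not affect the limit.\<close>
  then obtain N where N: "\<And>n. N \<le> n \<Longrightarrow> integral_functional M \<phi> (xs n) < ereal (a + 1)"
    by (auto simp: eventually_sequentially)
  define fn where "fn n = ae_rep (xs (n + N))" for n
  have fn: "integrable M (fn n)" "ae_class M (fn n) = xs (n + N)" for n
    unfolding fn_def using xs L1_space_carrierE by blast+
  have fn_le: "ereal_integral M (\<lambda>s. \<phi> (fn n s)) \<le> ereal (a + 1)" for n
    using N[of "n + N"] by (simp add: integral_functional_def fn_def less_imp_le)
  have fn_less: "ereal_integral M (\<lambda>s. \<phi> (fn n s)) < \<infinity>" for n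
    using fn_le[of n] by (rule le_less_trans) simp
  have fnD: "ereal_integral M (\<lambda>s. \<phi> (fn n s)) = ereal (LINT s|M. real_of_ereal (\<phi> (fn n s)))" for n
    by (rule integral_lessD[OF borel_measurable_integrable[OF fn(1)] fn_less])
  have "(\<lambda>n. LINT s|M. norm (fn n s - f s)) \<longlonglongrightarrow> 0"
  proof (rule L1_convergence[OF f(1) fn(1) _ f(3) fn_less])
    show "(\<lambda>n. LINT s|M. fn n s \<bullet> g s) \<longlonglongrightarrow> (LINT s|M. f s \<bullet> g s)"
      if "g \<in> borel_measurable M" "\<And>s. norm (g s) \<le> C" for g C
      using LIMSEQ_ignore_initial_segment[OF limitin_weak_topologyD[OF weak pairing_in_dual[OF that]], of N]
      by (simp add: pairing_def f_def fn_def)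
    have "(\<lambda>n. ereal (LINT s|M. real_of_ereal (\<phi> (fn n s)))) \<longlonglongrightarrow> ereal a"
      using LIMSEQ_ignore_initial_segment[OF lim, of N] fD
      unfolding fnD[symmetric] by (simp add: integral_functional_def f_def fn_def)
    then show "(\<lambda>n. LINT s|M. real_of_ereal (\<phi> (fn n s))) \<longlonglongrightarrow> (LINT s|M. real_of_ereal (\<phi> (f s)))"
      by (simp add: a_def)
    show "ereal_integral M (\<lambda>s. \<phi> (f s)) \<le> ereal (a + 1)" by (simp add: fD)
  qed (rule fn_le)
  moreover have "vnorm (L1_space M) (vminus (L1_space M) (xs (n + N)) F) = (LINT s|M. norm (fn n s - f s))" for n
  proof -
    have i: "integrable M (\<lambda>s. (-1) *\<^sub>R f s)" using f(1) by simp
    have s: "vscale (L1_space M) (-1) (ae_class M f) = ae_class M (\<lambda>s. (-1) *\<^sub>R f s)"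
      by (rule L1_space_ae_class(2)[OF f(1) f(1)])
    have "integrable M (\<lambda>s. fn n s + (-1) *\<^sub>R f s)" using f(1) fn(1)[of n] by simp
    note L1_space_ae_class(3)[OF this this]
    then show ?thesis
      unfolding vminus_def fn(2)[symmetric] f(2)[symmetric] s L1_space_ae_class(1)[OF fn(1) i] by simp
  qed
  ultimately have "(\<lambda>n. vnorm (L1_space M) (vminus (L1_space M) (xs (n + N)) F)) \<longlonglongrightarrow> 0" by simp
  then show "(\<lambda>n. vnorm (L1_space M) (vminus (L1_space M) (xs n) F)) \<longlonglongrightarrow> 0"
    by (rule LIMSEQ_offset)
qed

end

text \<open>\<open>differentiable_everywhere\<close> includes finiteness, so
  \<open>real_of_ereal\<close> loses no information, and differentiability gives continuity.\<close>

lemma strictly_convex_conjugate_differentiable: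
  fixes \<phi> :: "'e::euclidean_space \<Rightarrow> ereal"
  assumes "proper_function type_space \<phi>" "lower_semicontinuous \<phi>" "convex_function type_space \<phi>"
    "strictly_convex_on_dom type_space \<phi>" and diff: "differentiable_everywhere (fenchel_conjugate \<phi>)"
  shows "strictly_convex_conjugate \<phi> (\<lambda>y. real_of_ereal (fenchel_conjugate \<phi> y))"
proof (unfold_locales)
  show "fenchel_conjugate \<phi> = (\<lambda>y. ereal (real_of_ereal (fenchel_conjugate \<phi> y)))"
    using diff by (intro ext) (simp add: differentiable_everywhere_def ereal_real)
  show "continuous_on UNIV (\<lambda>y. real_of_ereal (fenchel_conjugate \<phi> y))"
    using diff by (intro continuous_at_imp_continuous_on)
      (auto simp: differentiable_everywhere_def intro: differentiable_imp_continuous_within)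
qed (use assms in auto)

theorem theorem6p4:
  fixes M :: "'s measure" and \<phi> :: "real ^ 'd \<Rightarrow> ereal"
  assumes "complete_measure M" and "finite_measure M" and "emeasure M (space M) \<noteq> 0"
    and "proper_function type_space \<phi>"
    and "lower_semicontinuous \<phi>"
    and "convex_function type_space \<phi>"
    and "strictly_convex_on_dom type_space \<phi>"
    and "differentiable_everywhere (fenchel_conjugate \<phi>)"
  shows "strongly_rotund (L1_space M) (integral_functional M \<phi>)"
proof -
  interpret convex_integral_functional M \<phi> "\<lambda>y. real_of_ereal (fenchel_conjugate \<phi> y)"
    by (intro convex_integral_functional.intro assms(2) strictly_convex_conjugate_differentiable assms(4-8))
  show ?thesis
    unfolding strongly_rotund_def
    using proper_integral_functional strictly_convex_integral_functional compactin_level_set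
      kadec_integral_functional by blast
qed

end
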